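(* Let $\mathcal{C}$ be a monoidal category with coequalizers, and assume that coequalizers are preserved by $\otimes$ and that the forgetful functor $|-|\colon\mathbf{Mon}\,\mathcal{C}\to\mathcal{C}$ has a left adjoint. Then the category $\mathbf{Mon}\,\mathcal{C}$ has coequalizers. Moreover, if $\mathcal{C}$ is cocomplete, then so is $\mathbf{Mon}\,\mathcal{C}$.
   Context: $\mathbf{Mon}\,\mathcal{C}$ is the category of monoids in the monoidal category $\mathcal{C}$ and monoid morphisms, and $|-|$ sends a monoid to its underlying object. "$\otimes$ preserves coequalizers" means that for each object $C$ of $\mathcal{C}$ the functors $C\otimes -$ and $-\otimes C$ preserve coequalizers. *)

theory Defs
  imports Main
begin

section \<open>Categories and functors\<close>

record ('o, 'm) category_data =
  Obj :: "'o set"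
  Arr :: "'m set"
  Dom :: "'m \<Rightarrow> 'o"
  Cod :: "'m \<Rightarrow> 'o"
  Idt :: "'o \<Rightarrow> 'm" ("\<one>\<index>")
  Comp :: "'m \<Rightarrow> 'm \<Rightarrow> 'm" (infixl "\<cdot>\<index>" 65)

definition Hom :: "('o, 'm, 'x) category_data_scheme \<Rightarrow> 'o \<Rightarrow> 'o \<Rightarrow> 'm set"
  where "Hom C A B = {f \<in> Arr C. Dom C f = A \<and> Cod C f = B}"

text \<open>Composition is written in the usual order and is meaningful for composable arrows only;
  the values of \<open>Idt\<close>, \<open>Comp\<close> and of functors outside the carriers are irrelevant.\<close>

locale category =
  fixes C :: "('o, 'm, 'x) category_data_scheme" (structure)
  assumes dom_in_Obj: "f \<in> Arr C \<Longrightarrow> Dom C f \<in> Obj C"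
    and cod_in_Obj: "f \<in> Arr C \<Longrightarrow> Cod C f \<in> Obj C"
    and idt_in_Hom: "A \<in> Obj C \<Longrightarrow> \<one> A \<in> Hom C A A"
    and comp_in_Hom: "\<lbrakk>f \<in> Hom C A B; g \<in> Hom C B D\<rbrakk> \<Longrightarrow> g \<cdot> f \<in> Hom C A D"
    and comp_idt_right: "f \<in> Hom C A B \<Longrightarrow> f \<cdot> \<one> A = f"
    and comp_idt_left: "f \<in> Hom C A B \<Longrightarrow> \<one> B \<cdot> f = f"
    and comp_assoc:
      "\<lbrakk>f \<in> Hom C A B; g \<in> Hom C B D; h \<in> Hom C D E\<rbrakk> \<Longrightarrow> (h \<cdot> g) \<cdot> f = h \<cdot> (g \<cdot> f)"

definition is_iso :: "('o, 'm, 'x) category_data_scheme \<Rightarrow> 'm \<Rightarrow> bool"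
  where "is_iso C f \<longleftrightarrow> (\<exists>A B g. f \<in> Hom C A B \<and> g \<in> Hom C B A \<and>
    Comp C g f = Idt C A \<and> Comp C f g = Idt C B)"

record ('o, 'm, 'p, 'n) functor_data =
  on_obj :: "'o \<Rightarrow> 'p"
  on_arr :: "'m \<Rightarrow> 'n"

locale cat_functor = src: category C + tgt: category D
  for C :: "('o, 'm, 'x) category_data_scheme"
    and D :: "('p, 'n, 'y) category_data_scheme"
    and F :: "('o, 'm, 'p, 'n) functor_data" +
  assumes on_obj_in_Obj: "A \<in> Obj C \<Longrightarrow> on_obj F A \<in> Obj D"
    and on_arr_in_Hom: "f \<in> Hom C A B \<Longrightarrow> on_arr F f \<in> Hom D (on_obj F A) (on_obj F B)"
    and on_arr_idt: "A \<in> Obj C \<Longrightarrow> on_arr F (Idt C A) = Idt D (on_obj F A)"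
    and on_arr_comp: "\<lbrakk>f \<in> Hom C A B; g \<in> Hom C B E\<rbrakk> \<Longrightarrow>
      on_arr F (Comp C g f) = Comp D (on_arr F g) (on_arr F f)"

definition is_adjunction ::
    "('o, 'm, 'x) category_data_scheme \<Rightarrow> ('p, 'n, 'y) category_data_scheme \<Rightarrow>
     ('o, 'm, 'p, 'n) functor_data \<Rightarrow> ('p, 'n, 'o, 'm) functor_data \<Rightarrow>
     ('o \<Rightarrow> 'p \<Rightarrow> 'n \<Rightarrow> 'm) \<Rightarrow> bool"
  where "is_adjunction C D F U \<phi> \<longleftrightarrow>
    cat_functor C D F \<and> cat_functor D C U \<and>
    (\<forall>X\<in>Obj C. \<forall>A\<in>Obj D. bij_betw (\<phi> X A) (Hom D (on_obj F X) A) (Hom C X (on_obj U A))) \<and>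
    (\<forall>X\<in>Obj C. \<forall>A\<in>Obj D. \<forall>A'\<in>Obj D. \<forall>f\<in>Hom D (on_obj F X) A. \<forall>k\<in>Hom D A A'.
      \<phi> X A' (Comp D k f) = Comp C (on_arr U k) (\<phi> X A f)) \<and>
    (\<forall>X\<in>Obj C. \<forall>X'\<in>Obj C. \<forall>A\<in>Obj D. \<forall>f\<in>Hom D (on_obj F X) A. \<forall>h\<in>Hom C X' X.
      \<phi> X' A (Comp D f (on_arr F h)) = Comp C (\<phi> X A f) h)"

definition has_left_adjoint ::
    "('p, 'n, 'y) category_data_scheme \<Rightarrow> ('o, 'm, 'x) category_data_scheme \<Rightarrow>
     ('p, 'n, 'o, 'm) functor_data \<Rightarrow> bool"
  where "has_left_adjoint D C U \<longleftrightarrow> (\<exists>F \<phi>. is_adjunction C D F U \<phi>)"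

section \<open>Coequalizers and colimits\<close>

definition is_coequalizer :: "('o, 'm, 'x) category_data_scheme \<Rightarrow> 'm \<Rightarrow> 'm \<Rightarrow> 'm \<Rightarrow> bool"
  where "is_coequalizer C f g q \<longleftrightarrow>
    (\<exists>A B Q. f \<in> Hom C A B \<and> g \<in> Hom C A B \<and> q \<in> Hom C B Q \<and> Comp C q f = Comp C q g \<and>
      (\<forall>X. \<forall>h\<in>Hom C B X. Comp C h f = Comp C h g \<longrightarrow> (\<exists>!k. k \<in> Hom C Q X \<and> Comp C k q = h)))"

definition has_coequalizers :: "('o, 'm, 'x) category_data_scheme \<Rightarrow> bool"
  where "has_coequalizers C \<longleftrightarrow>
    (\<forall>A B. \<forall>f\<in>Hom C A B. \<forall>g\<in>Hom C A B. \<exists>q. is_coequalizer C f g q)"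

definition preserves_coequalizers ::
    "('o, 'm, 'x) category_data_scheme \<Rightarrow> ('p, 'n, 'y) category_data_scheme \<Rightarrow>
     ('o, 'm, 'p, 'n) functor_data \<Rightarrow> bool"
  where "preserves_coequalizers C D F \<longleftrightarrow>
    (\<forall>f g q. is_coequalizer C f g q \<longrightarrow>
      is_coequalizer D (on_arr F f) (on_arr F g) (on_arr F q))"

definition is_cocone ::
    "('i, 'j, 'z) category_data_scheme \<Rightarrow> ('o, 'm, 'x) category_data_scheme \<Rightarrow>
     ('i, 'j, 'o, 'm) functor_data \<Rightarrow> 'o \<Rightarrow> ('i \<Rightarrow> 'm) \<Rightarrow> bool"
  where "is_cocone J C D X c \<longleftrightarrow> X \<in> Obj C \<and>
    (\<forall>i\<in>Obj J. c i \<in> Hom C (on_obj D i) X) \<and>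
    (\<forall>i\<in>Obj J. \<forall>j\<in>Obj J. \<forall>u\<in>Hom J i j. Comp C (c j) (on_arr D u) = c i)"

definition is_colimit ::
    "('i, 'j, 'z) category_data_scheme \<Rightarrow> ('o, 'm, 'x) category_data_scheme \<Rightarrow>
     ('i, 'j, 'o, 'm) functor_data \<Rightarrow> 'o \<Rightarrow> ('i \<Rightarrow> 'm) \<Rightarrow> bool"
  where "is_colimit J C D X c \<longleftrightarrow> is_cocone J C D X c \<and>
    (\<forall>Y d. is_cocone J C D Y d \<longrightarrow>
      (\<exists>!k. k \<in> Hom C X Y \<and> (\<forall>i\<in>Obj J. Comp C k (c i) = d i)))"

text \<open>Smallness is measured by a cardinal \<open>\<kappa>\<close>: a category is small if it has fewer than \<open>\<kappa>\<close>
  arrows (hence fewer than \<open>\<kappa>\<close> objects). For a Grothendieck universe and \<open>\<kappa>\<close> its cardinality this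
  is, up to isomorphism of index categories, the usual smallness. Index categories may
  be taken with objects and arrows in the type carrying \<open>\<kappa>\<close>, since a set with fewer than
  \<open>\<kappa>\<close> elements embeds into the field of \<open>\<kappa>\<close>.\<close>

definition small_category :: "'k rel \<Rightarrow> ('i, 'j, 'z) category_data_scheme \<Rightarrow> bool"
  where "small_category \<kappa> J \<longleftrightarrow> category J \<and> (card_of (Arr J), \<kappa>) \<in> ordLess"

definition cocomplete :: "'k rel \<Rightarrow> ('o, 'm, 'x) category_data_scheme \<Rightarrow> bool"
  where "cocomplete \<kappa> C \<longleftrightarrow>
    (\<forall>(J :: ('k, 'k) category_data) D.
      small_category \<kappa> J \<and> cat_functor J C D \<longrightarrow> (\<exists>X c. is_colimit J C D X c))"

section \<open>Monoidal categories\<close>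

record ('o, 'm) monoidal_data = "('o, 'm) category_data" +
  tensor_obj :: "'o \<Rightarrow> 'o \<Rightarrow> 'o" (infixl "\<otimes>\<index>" 70)
  tensor_arr :: "'m \<Rightarrow> 'm \<Rightarrow> 'm" (infixl "\<boxtimes>\<index>" 70)
  unit_obj :: "'o" ("\<I>\<index>")
  associator :: "'o \<Rightarrow> 'o \<Rightarrow> 'o \<Rightarrow> 'm" ("\<alpha>\<index>")
  left_unitor :: "'o \<Rightarrow> 'm" ("\<ll>\<index>")
  right_unitor :: "'o \<Rightarrow> 'm" ("\<rho>\<index>")

locale monoidal_category = category C
  for C :: "('o, 'm, 'x) monoidal_data_scheme" (structure) +
  assumes tensor_obj_in_Obj: "\<lbrakk>A \<in> Obj C; B \<in> Obj C\<rbrakk> \<Longrightarrow> A \<otimes> B \<in> Obj C"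
    and tensor_arr_in_Hom:
      "\<lbrakk>f \<in> Hom C A A'; g \<in> Hom C B B'\<rbrakk> \<Longrightarrow> f \<boxtimes> g \<in> Hom C (A \<otimes> B) (A' \<otimes> B')"
    and tensor_idt: "\<lbrakk>A \<in> Obj C; B \<in> Obj C\<rbrakk> \<Longrightarrow> \<one> A \<boxtimes> \<one> B = \<one> (A \<otimes> B)"
    and interchange:
      "\<lbrakk>f \<in> Hom C A A'; f' \<in> Hom C A' A''; g \<in> Hom C B B'; g' \<in> Hom C B' B''\<rbrakk> \<Longrightarrow>
        (f' \<cdot> f) \<boxtimes> (g' \<cdot> g) = (f' \<boxtimes> g') \<cdot> (f \<boxtimes> g)"
    and unit_in_Obj: "\<I> \<in> Obj C"
    and associator_in_Hom: "\<lbrakk>X \<in> Obj C; Y \<in> Obj C; Z \<in> Obj C\<rbrakk> \<Longrightarrow>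
      \<alpha> X Y Z \<in> Hom C ((X \<otimes> Y) \<otimes> Z) (X \<otimes> (Y \<otimes> Z))"
    and associator_iso: "\<lbrakk>X \<in> Obj C; Y \<in> Obj C; Z \<in> Obj C\<rbrakk> \<Longrightarrow> is_iso C (\<alpha> X Y Z)"
    and associator_natural:
      "\<lbrakk>f \<in> Hom C X X'; g \<in> Hom C Y Y'; h \<in> Hom C Z Z'\<rbrakk> \<Longrightarrow>
        \<alpha> X' Y' Z' \<cdot> ((f \<boxtimes> g) \<boxtimes> h) = (f \<boxtimes> (g \<boxtimes> h)) \<cdot> \<alpha> X Y Z"
    and left_unitor_in_Hom: "X \<in> Obj C \<Longrightarrow> \<ll> X \<in> Hom C (\<I> \<otimes> X) X"
    and left_unitor_iso: "X \<in> Obj C \<Longrightarrow> is_iso C (\<ll> X)"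
    and left_unitor_natural: "f \<in> Hom C X Y \<Longrightarrow> \<ll> Y \<cdot> (\<one> \<I> \<boxtimes> f) = f \<cdot> \<ll> X"
    and right_unitor_in_Hom: "X \<in> Obj C \<Longrightarrow> \<rho> X \<in> Hom C (X \<otimes> \<I>) X"
    and right_unitor_iso: "X \<in> Obj C \<Longrightarrow> is_iso C (\<rho> X)"
    and right_unitor_natural: "f \<in> Hom C X Y \<Longrightarrow> \<rho> Y \<cdot> (f \<boxtimes> \<one> \<I>) = f \<cdot> \<rho> X"
    and pentagon: "\<lbrakk>W \<in> Obj C; X \<in> Obj C; Y \<in> Obj C; Z \<in> Obj C\<rbrakk> \<Longrightarrow>
      \<alpha> W X (Y \<otimes> Z) \<cdot> \<alpha> (W \<otimes> X) Y Z =
      (\<one> W \<boxtimes> \<alpha> X Y Z) \<cdot> \<alpha> W (X \<otimes> Y) Z \<cdot> (\<alpha> W X Y \<boxtimes> \<one> Z)"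
    and triangle: "\<lbrakk>X \<in> Obj C; Y \<in> Obj C\<rbrakk> \<Longrightarrow>
      (\<one> X \<boxtimes> \<ll> Y) \<cdot> \<alpha> X \<I> Y = \<rho> X \<boxtimes> \<one> Y"

definition tensor_left ::
    "('o, 'm, 'x) monoidal_data_scheme \<Rightarrow> 'o \<Rightarrow> ('o, 'm, 'o, 'm) functor_data"
  where "tensor_left C A =
    \<lparr>on_obj = (\<lambda>X. tensor_obj C A X), on_arr = (\<lambda>f. tensor_arr C (Idt C A) f)\<rparr>"

definition tensor_right ::
    "('o, 'm, 'x) monoidal_data_scheme \<Rightarrow> 'o \<Rightarrow> ('o, 'm, 'o, 'm) functor_data"
  where "tensor_right C A =
    \<lparr>on_obj = (\<lambda>X. tensor_obj C X A), on_arr = (\<lambda>f. tensor_arr C f (Idt C A))\<rparr>"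

definition tensor_preserves_coequalizers :: "('o, 'm, 'x) monoidal_data_scheme \<Rightarrow> bool"
  where "tensor_preserves_coequalizers C \<longleftrightarrow>
    (\<forall>A\<in>Obj C. preserves_coequalizers C C (tensor_left C A) \<and>
      preserves_coequalizers C C (tensor_right C A))"

section \<open>Monoids\<close>

text \<open>A monoid is a triple \<open>(M, \<mu>, \<eta>)\<close> of object, multiplication and unit.\<close>

definition is_monoid :: "('o, 'm, 'x) monoidal_data_scheme \<Rightarrow> 'o \<times> 'm \<times> 'm \<Rightarrow> bool"
  where "is_monoid C = (\<lambda>(M, \<mu>, \<eta>). M \<in> Obj C \<and>
    \<mu> \<in> Hom C (tensor_obj C M M) M \<and> \<eta> \<in> Hom C (unit_obj C) M \<and>
    Comp C \<mu> (tensor_arr C \<mu> (Idt C M)) =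
      Comp C (Comp C \<mu> (tensor_arr C (Idt C M) \<mu>)) (associator C M M M) \<and>
    Comp C \<mu> (tensor_arr C \<eta> (Idt C M)) = left_unitor C M \<and>
    Comp C \<mu> (tensor_arr C (Idt C M) \<eta>) = right_unitor C M)"

definition is_monoid_morphism ::
    "('o, 'm, 'x) monoidal_data_scheme \<Rightarrow> 'o \<times> 'm \<times> 'm \<Rightarrow> 'm \<Rightarrow> 'o \<times> 'm \<times> 'm \<Rightarrow> bool"
  where "is_monoid_morphism C = (\<lambda>(M, \<mu>, \<eta>) f (M', \<mu>', \<eta>'). f \<in> Hom C M M' \<and>
    Comp C f \<mu> = Comp C \<mu>' (tensor_arr C f f) \<and> Comp C f \<eta> = \<eta>')"

text \<open>An arrow of \<open>Mon C\<close> is a triple \<open>(A, f, B)\<close>: it must record the monoid structures on its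
  source and target, which the arrow \<open>f\<close> of \<open>C\<close> does not determine.\<close>

definition Mon :: "('o, 'm, 'x) monoidal_data_scheme \<Rightarrow>
    ('o \<times> 'm \<times> 'm, ('o \<times> 'm \<times> 'm) \<times> 'm \<times> ('o \<times> 'm \<times> 'm)) category_data"
  where "Mon C =
    \<lparr>Obj = {A. is_monoid C A},
     Arr = {(A, f, B). is_monoid C A \<and> is_monoid C B \<and> is_monoid_morphism C A f B},
     Dom = (\<lambda>(A, f, B). A),
     Cod = (\<lambda>(A, f, B). B),
     Idt = (\<lambda>A. (A, Idt C (fst A), A)),
     Comp = (\<lambda>(B', g, D) (A, f, B). (A, Comp C g f, D))\<rparr>"

definition forgetful :: "('o, 'm, 'x) monoidal_data_scheme \<Rightarrow>
    ('o \<times> 'm \<times> 'm, ('o \<times> 'm \<times> 'm) \<times> 'm \<times> ('o \<times> 'm \<times> 'm), 'o, 'm) functor_data"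
  where "forgetful C = \<lparr>on_obj = fst, on_arr = (\<lambda>(A, f, B). f)\<rparr>"

section \<open>Well-definedness\<close>

context monoidal_category
begin

lemma Hom_Mon: "Hom (Mon C) A B =
    {(A, f, B) |f. is_monoid C A \<and> is_monoid C B \<and> is_monoid_morphism C A f B}"
  by (auto simp: Hom_def Mon_def)

lemma HomD: "f \<in> Hom C A B \<Longrightarrow> A \<in> Obj C \<and> B \<in> Obj C"
  using dom_in_Obj cod_in_Obj by (auto simp: Hom_def)

lemma monoid_morphism_idt: "is_monoid C A \<Longrightarrow> is_monoid_morphism C A (\<one> (fst A)) A"
  by (auto simp: is_monoid_def is_monoid_morphism_def idt_in_Hom tensor_idt comp_idt_left
      comp_idt_right split: prod.splits)

lemma monoid_morphism_comp:
  assumes A: "is_monoid C A" and B: "is_monoid C B" and D: "is_monoid C D"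
    and f: "is_monoid_morphism C A f B" and g: "is_monoid_morphism C B g D"
  shows "is_monoid_morphism C A (g \<cdot> f) D"
proof -
  obtain M \<mu> \<eta> where a: "A = (M, \<mu>, \<eta>)" by (cases A)
  obtain M' \<mu>' \<eta>' where b: "B = (M', \<mu>', \<eta>')" by (cases B)
  obtain M'' \<mu>'' \<eta>'' where d: "D = (M'', \<mu>'', \<eta>'')" by (cases D)
  have fh: "f \<in> Hom C M M'" and gh: "g \<in> Hom C M' M''"
    and fm: "f \<cdot> \<mu> = \<mu>' \<cdot> (f \<boxtimes> f)" and gm: "g \<cdot> \<mu>' = \<mu>'' \<cdot> (g \<boxtimes> g)"
    and fe: "f \<cdot> \<eta> = \<eta>'" and ge: "g \<cdot> \<eta>' = \<eta>''"
    using f g by (auto simp: is_monoid_morphism_def a b d)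
  have m: "\<mu> \<in> Hom C (M \<otimes> M) M" "\<eta> \<in> Hom C \<I> M" "\<mu>' \<in> Hom C (M' \<otimes> M') M'"
      "\<mu>'' \<in> Hom C (M'' \<otimes> M'') M''"
    using A B D by (auto simp: is_monoid_def a b d)
  have ff: "f \<boxtimes> f \<in> Hom C (M \<otimes> M) (M' \<otimes> M')" and gg: "g \<boxtimes> g \<in> Hom C (M' \<otimes> M') (M'' \<otimes> M'')"
    using fh gh by (auto intro: tensor_arr_in_Hom)
  have "(g \<cdot> f) \<cdot> \<mu> = g \<cdot> (\<mu>' \<cdot> (f \<boxtimes> f))"
    using comp_assoc[OF m(1) fh gh] fm by simp
  also have "\<dots> = (\<mu>'' \<cdot> (g \<boxtimes> g)) \<cdot> (f \<boxtimes> f)"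
    using comp_assoc[OF ff m(3) gh] gm by simp
  also have "\<dots> = \<mu>'' \<cdot> ((g \<cdot> f) \<boxtimes> (g \<cdot> f))"
    using comp_assoc[OF ff gg m(4)] interchange[OF fh gh fh gh] by simp
  finally have "(g \<cdot> f) \<cdot> \<mu> = \<mu>'' \<cdot> ((g \<cdot> f) \<boxtimes> (g \<cdot> f))" .
  moreover have "(g \<cdot> f) \<cdot> \<eta> = \<eta>''"
    using comp_assoc[OF m(2) fh gh] fe ge by simp
  ultimately show ?thesis
    using comp_in_Hom[OF fh gh] by (simp add: is_monoid_morphism_def a d)
qed

lemma monoid_morphism_Hom: "is_monoid_morphism C A f B \<Longrightarrow> f \<in> Hom C (fst A) (fst B)"
  by (auto simp: is_monoid_morphism_def split: prod.splits)

lemma category_Mon: "category (Mon C)"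
proof
  fix f assume "f \<in> Arr (Mon C)"
  then show "Dom (Mon C) f \<in> Obj (Mon C)" "Cod (Mon C) f \<in> Obj (Mon C)"
    by (auto simp: Mon_def)
next
  fix A assume "A \<in> Obj (Mon C)"
  then show "\<one>\<^bsub>Mon C\<^esub> A \<in> Hom (Mon C) A A"
    unfolding Hom_Mon using monoid_morphism_idt by (auto simp: Mon_def)
next
  fix f g A B D assume "f \<in> Hom (Mon C) A B" "g \<in> Hom (Mon C) B D"
  then show "g \<cdot>\<^bsub>Mon C\<^esub> f \<in> Hom (Mon C) A D"
    unfolding Hom_Mon using monoid_morphism_comp[of A B D] by (auto simp: Mon_def)
next
  fix f A B assume "f \<in> Hom (Mon C) A B"
  then obtain h where f: "f = (A, h, B)" and "is_monoid_morphism C A h B"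
    unfolding Hom_Mon by blast
  then have h: "h \<in> Hom C (fst A) (fst B)" by (simp add: monoid_morphism_Hom)
  show "f \<cdot>\<^bsub>Mon C\<^esub> \<one>\<^bsub>Mon C\<^esub> A = f" "\<one>\<^bsub>Mon C\<^esub> B \<cdot>\<^bsub>Mon C\<^esub> f = f"
    using comp_idt_right[OF h] comp_idt_left[OF h] by (simp_all add: Mon_def f)
next
  fix f g h A B D E
  assume "f \<in> Hom (Mon C) A B" "g \<in> Hom (Mon C) B D" "h \<in> Hom (Mon C) D E"
  then obtain f' g' h' where eqs: "f = (A, f', B)" "g = (B, g', D)" "h = (D, h', E)"
    and "is_monoid_morphism C A f' B" "is_monoid_morphism C B g' D" "is_monoid_morphism C D h' E"
    unfolding Hom_Mon by blast
  then show "(h \<cdot>\<^bsub>Mon C\<^esub> g) \<cdot>\<^bsub>Mon C\<^esub> f = h \<cdot>\<^bsub>Mon C\<^esub> (g \<cdot>\<^bsub>Mon C\<^esub> f)"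
    using comp_assoc[of f' "fst A" "fst B" g' "fst D" h' "fst E"]
    by (simp add: Mon_def monoid_morphism_Hom)
qed

lemma cat_functor_forgetful: "cat_functor (Mon C) C (forgetful C)"
proof -
  interpret M: category "Mon C" by (rule category_Mon)
  show ?thesis
  proof
    fix A assume "A \<in> Obj (Mon C)"
    then show "on_obj (forgetful C) A \<in> Obj C"
      by (auto simp: Mon_def forgetful_def is_monoid_def)
  next
    fix f A B assume "f \<in> Hom (Mon C) A B"
    then obtain h where "f = (A, h, B)" "is_monoid_morphism C A h B"
      unfolding Hom_Mon by blast
    then show "on_arr (forgetful C) f \<in> Hom C (on_obj (forgetful C) A) (on_obj (forgetful C) B)"
      by (simp add: forgetful_def monoid_morphism_Hom)
  next
    fix A assume "A \<in> Obj (Mon C)"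
    show "on_arr (forgetful C) (\<one>\<^bsub>Mon C\<^esub> A) = \<one> (on_obj (forgetful C) A)"
      by (simp add: Mon_def forgetful_def)
  next
    fix f g A B E assume "f \<in> Hom (Mon C) A B" "g \<in> Hom (Mon C) B E"
    then show "on_arr (forgetful C) (g \<cdot>\<^bsub>Mon C\<^esub> f) = on_arr (forgetful C) g \<cdot> on_arr (forgetful C) f"
      unfolding Hom_Mon by (auto simp: Mon_def forgetful_def)
  qed
qed

lemma cat_functor_tensor_left:
  assumes "A \<in> Obj C"
  shows "cat_functor C C (tensor_left C A)"
proof (intro cat_functor.intro cat_functor_axioms.intro category_axioms)
  note A = idt_in_Hom[OF assms]
  show "on_obj (tensor_left C A) X \<in> Obj C" if "X \<in> Obj C" for X
    using assms that by (simp add: tensor_left_def tensor_obj_in_Obj)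
  show "on_arr (tensor_left C A) f \<in>
      Hom C (on_obj (tensor_left C A) X) (on_obj (tensor_left C A) Y)" if "f \<in> Hom C X Y" for f X Y
    using tensor_arr_in_Hom[OF A that] by (simp add: tensor_left_def)
  show "on_arr (tensor_left C A) (\<one> X) = \<one> (on_obj (tensor_left C A) X)" if "X \<in> Obj C" for X
    using assms that by (simp add: tensor_left_def tensor_idt)
  show "on_arr (tensor_left C A) (g \<cdot> f) =
      on_arr (tensor_left C A) g \<cdot> on_arr (tensor_left C A) f"
    if "f \<in> Hom C X Y" "g \<in> Hom C Y Z" for f g X Y Z
    using interchange[OF A A that] comp_idt_left[OF A] by (simp add: tensor_left_def)
qed

lemma cat_functor_tensor_right:
  assumes "A \<in> Obj C"
  shows "cat_functor C C (tensor_right C A)"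
proof (intro cat_functor.intro cat_functor_axioms.intro category_axioms)
  note A = idt_in_Hom[OF assms]
  show "on_obj (tensor_right C A) X \<in> Obj C" if "X \<in> Obj C" for X
    using assms that by (simp add: tensor_right_def tensor_obj_in_Obj)
  show "on_arr (tensor_right C A) f \<in>
      Hom C (on_obj (tensor_right C A) X) (on_obj (tensor_right C A) Y)" if "f \<in> Hom C X Y" for f X Y
    using tensor_arr_in_Hom[OF that A] by (simp add: tensor_right_def)
  show "on_arr (tensor_right C A) (\<one> X) = \<one> (on_obj (tensor_right C A) X)" if "X \<in> Obj C" for X
    using assms that by (simp add: tensor_right_def tensor_idt)
  show "on_arr (tensor_right C A) (g \<cdot> f) =
      on_arr (tensor_right C A) g \<cdot> on_arr (tensor_right C A) f"
    if "f \<in> Hom C X Y" "g \<in> Hom C Y Z" for f g X Y Z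
    using interchange[OF that A A] comp_idt_left[OF A] by (simp add: tensor_right_def)
qed

end

end

theory Submission
  imports Defs
begin

text \<open>
  The two claims rest on different ideas.

  \<^emph>\<open>Coequalizers.\<close> As for rings, the coequalizer of \<open>f, g : A \<rightarrow> B\<close> in \<open>Mon C\<close> is the quotient of
  \<open>B\<close> by the two-sided ideal, or congruence, that identifies \<open>f a\<close> with \<open>g a\<close>. It can be formed in
  \<open>C\<close> in one step, as the coequalizer \<open>q\<close> of the two arrows \<open>(B \<otimes> A) \<otimes> B \<rightarrow> B\<close> that send
  \<open>(b, a, b')\<close> to \<open>b \<sqdot> f a \<sqdot> b'\<close> and \<open>b \<sqdot> g a \<sqdot> b'\<close> (\<open>ideal_action\<close>). These arrows are linear over \<open>B\<close>
  on both sides, and tensoring preserves the coequalizer \<open>q\<close>; hence the multiplication of \<open>B\<close> descends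
  along \<open>q \<otimes> q\<close>, one factor at a time (\<open>quotient_monoid\<close>). Putting units for \<open>b\<close> and \<open>b'\<close> shows that
  \<open>q\<close> equalizes \<open>f\<close> and \<open>g\<close>, and every morphism of monoids that equalizes \<open>f\<close> and \<open>g\<close> equalizes the two
  actions.

  \<^emph>\<open>Colimits.\<close> For a diagram \<open>E\<close> of monoids let \<open>X\<close> be the colimit of the underlying objects \<open>U E\<close>,
  with cocone \<open>c\<close>, and let \<open>F X\<close> be the free monoid on \<open>X\<close>. The arrows \<open>U (E i) \<rightarrow> X \<rightarrow> U (F X)\<close> form
  a cocone in \<open>C\<close>; the colimit of \<open>E\<close> is the universal quotient of \<open>F X\<close> that turns them into
  morphisms of monoids. Since the counit \<open>\<epsilon>\<close> is split epi in \<open>C\<close>, an arrow out of \<open>U (E i)\<close> is a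
  morphism as soon as its composite with \<open>U (\<epsilon> i)\<close> is one, so the condition on \<open>i\<close> is the equality of
  two arrows \<open>U F U (E i) \<rightarrow> U (F X)\<close>. The conditions for all \<open>i\<close> combine into a single pair of arrows out
  of \<open>F L\<close>, where \<open>L\<close> is the colimit of \<open>U F U E\<close>. A coequalizer of this pair exists by the first part.
  The colimits formed in \<open>C\<close> have the same shape as \<open>E\<close>, so the bound on the size of diagrams is
  respected (\<open>colimits_along_right_adjoint\<close>).
\<close>

section \<open>Calculating with composable arrows\<close>

definition epic :: "('o, 'm, 'x) category_data_scheme \<Rightarrow> 'm \<Rightarrow> bool"
  where "epic C e \<longleftrightarrow> e \<in> Arr C \<and>
    (\<forall>X. \<forall>g\<in>Hom C (Cod C e) X. \<forall>h\<in>Hom C (Cod C e) X. Comp C g e = Comp C h e \<longrightarrow> g = h)"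

lemma Hom_iff: "f \<in> Hom C A B \<longleftrightarrow> f \<in> Arr C \<and> Dom C f = A \<and> Cod C f = B"
  by (auto simp: Hom_def)

context category
begin

lemma idt_arr:
  assumes "A \<in> Obj C"
  shows "\<one> A \<in> Arr C" "Dom C (\<one> A) = A" "Cod C (\<one> A) = A"
  using idt_in_Hom[OF assms] by (auto simp: Hom_iff)

lemma comp_arr:
  assumes "f \<in> Arr C" "g \<in> Arr C" "Dom C g = Cod C f"
  shows "g \<cdot> f \<in> Arr C" "Dom C (g \<cdot> f) = Dom C f" "Cod C (g \<cdot> f) = Cod C g"
  using comp_in_Hom[of f "Dom C f" "Cod C f" g "Cod C g"] assms by (auto simp: Hom_iff)

lemma comp_idt_arr:
  assumes "f \<in> Arr C"
  shows "Dom C f = A \<Longrightarrow> f \<cdot> \<one> A = f" "Cod C f = A \<Longrightarrow> \<one> A \<cdot> f = f"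
  using comp_idt_right[of f] comp_idt_left[of f] assms by (auto simp: Hom_iff)

lemma comp_assoc_arr:
  assumes "f \<in> Arr C" "g \<in> Arr C" "h \<in> Arr C" "Dom C g = Cod C f" "Dom C h = Cod C g"
  shows "(h \<cdot> g) \<cdot> f = h \<cdot> (g \<cdot> f)"
  using comp_assoc[of f "Dom C f" "Cod C f" g "Cod C g" h "Cod C h"] assms
  by (auto simp: Hom_iff)

text \<open>The category laws are restated with \<open>Arr\<close>, \<open>Dom\<close> and \<open>Cod\<close> because the hom-set form has
  objects in its premises that do not occur in the equation, so that rewriting could not determine
  them.\<close>

lemmas arr_simps = Hom_iff dom_in_Obj cod_in_Obj idt_arr comp_arr comp_idt_arr comp_assoc_arr

lemma epic_cancel:
  assumes "epic C e" "g \<in> Arr C" "h \<in> Arr C" "Dom C g = Cod C e" "Dom C h = Cod C e"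
    "g \<cdot> e = h \<cdot> e"
  shows "g = h"
proof -
  have "e \<in> Arr C" using assms(1) by (simp add: epic_def)
  then have "Cod C g = Cod C h" using assms(2-6) comp_arr(3) by metis
  then show ?thesis using assms by (auto simp: epic_def Hom_iff)
qed

lemma epic_comp:
  assumes "epic C e" "epic C e'" "Dom C e' = Cod C e"
  shows "epic C (e' \<cdot> e)"
  unfolding epic_def
proof (intro conjI ballI allI impI)
  have e: "e \<in> Arr C" "e' \<in> Arr C" using assms by (auto simp: epic_def)
  show "e' \<cdot> e \<in> Arr C" using e assms(3) by (simp add: arr_simps)
  fix X g h
  assume "g \<in> Hom C (Cod C (e' \<cdot> e)) X" "h \<in> Hom C (Cod C (e' \<cdot> e)) X"
    and eq: "g \<cdot> (e' \<cdot> e) = h \<cdot> (e' \<cdot> e)"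
  then have gh: "g \<in> Arr C" "h \<in> Arr C" "Dom C g = Cod C e'" "Dom C h = Cod C e'"
    using e assms(3) by (auto simp: arr_simps)
  have "g \<cdot> e' = h \<cdot> e'"
    by (rule epic_cancel[OF assms(1)]) (use e gh eq assms(3) in \<open>simp_all add: arr_simps\<close>)
  then show "g = h" using epic_cancel[OF assms(2)] gh by blast
qed

lemma split_epic:
  assumes "e \<in> Hom C A B" "s \<in> Hom C B A" "e \<cdot> s = \<one> B"
  shows "epic C e"
  unfolding epic_def
proof (intro conjI ballI allI impI)
  show "e \<in> Arr C" using assms by (simp add: Hom_iff)
  fix X g h
  assume "g \<in> Hom C (Cod C e) X" "h \<in> Hom C (Cod C e) X" and eq: "g \<cdot> e = h \<cdot> e"
  then have gh: "g \<in> Arr C" "h \<in> Arr C" "Dom C g = B" "Dom C h = B"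
    using assms by (auto simp: Hom_iff)
  have "g \<cdot> (e \<cdot> s) = h \<cdot> (e \<cdot> s)"
    using assms gh comp_assoc_arr[of s e g] comp_assoc_arr[of s e h] eq by (simp add: Hom_iff)
  then show "g = h" using assms(3) gh by (simp add: comp_idt_arr)
qed

lemma iso_epic: "is_iso C f \<Longrightarrow> epic C f"
  unfolding is_iso_def using split_epic by metis

lemma coequalizer_arr:
  assumes "is_coequalizer C f g q"
  shows "f \<in> Arr C" "g \<in> Arr C" "q \<in> Arr C" "Dom C g = Dom C f" "Cod C g = Cod C f"
    "Dom C q = Cod C f" "q \<cdot> f = q \<cdot> g"
  using assms unfolding is_coequalizer_def by (auto simp: Hom_iff)

lemma coequalizer_factor:
  assumes "is_coequalizer C f g q" "h \<in> Arr C" "Dom C h = Cod C f" "h \<cdot> f = h \<cdot> g"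
  obtains k where "k \<in> Hom C (Cod C q) (Cod C h)" "k \<cdot> q = h"
proof -
  obtain A B Q where f: "f \<in> Hom C A B" and q: "q \<in> Hom C B Q"
    and univ: "\<And>X h. h \<in> Hom C B X \<Longrightarrow> h \<cdot> f = h \<cdot> g \<Longrightarrow> \<exists>!k. k \<in> Hom C Q X \<and> k \<cdot> q = h"
    using assms(1) unfolding is_coequalizer_def by metis
  have "h \<in> Hom C B (Cod C h)" using assms(2,3) f by (simp add: Hom_iff)
  then show ?thesis using univ[OF _ assms(4)] that q by (metis Hom_iff)
qed

lemma coequalizer_epic:
  assumes "is_coequalizer C f g q"
  shows "epic C q"
proof -
  note q = coequalizer_arr[OF assms]
  have "k = k'" if k: "k \<in> Hom C (Cod C q) X" "k' \<in> Hom C (Cod C q) X" "k \<cdot> q = k' \<cdot> q" for k k' X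
  proof -
    have "k \<cdot> q \<in> Hom C (Cod C f) X" "(k \<cdot> q) \<cdot> f = (k \<cdot> q) \<cdot> g"
      using k(1) q by (auto simp: arr_simps)
    then have "\<exists>!j. j \<in> Hom C (Cod C q) X \<and> j \<cdot> q = k \<cdot> q"
      using assms unfolding is_coequalizer_def by (auto simp: Hom_iff)
    then show ?thesis using k by metis
  qed
  then show ?thesis using q by (auto simp: epic_def)
qed

end

context monoidal_category
begin

lemma tensor_arr:
  assumes "f \<in> Arr C" "g \<in> Arr C"
  shows "f \<boxtimes> g \<in> Arr C" "Dom C (f \<boxtimes> g) = Dom C f \<otimes> Dom C g"
    "Cod C (f \<boxtimes> g) = Cod C f \<otimes> Cod C g"
  using tensor_arr_in_Hom[of f _ _ g] assms by (auto simp: Hom_iff)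

lemma associator_arr:
  assumes "X \<in> Obj C" "Y \<in> Obj C" "Z \<in> Obj C"
  shows "\<alpha> X Y Z \<in> Arr C" "Dom C (\<alpha> X Y Z) = (X \<otimes> Y) \<otimes> Z" "Cod C (\<alpha> X Y Z) = X \<otimes> (Y \<otimes> Z)"
  using associator_in_Hom[OF assms] by (auto simp: Hom_iff)

lemma unitor_arr:
  assumes "X \<in> Obj C"
  shows "\<ll> X \<in> Arr C" "Dom C (\<ll> X) = \<I> \<otimes> X" "Cod C (\<ll> X) = X"
    "\<rho> X \<in> Arr C" "Dom C (\<rho> X) = X \<otimes> \<I>" "Cod C (\<rho> X) = X"
  using left_unitor_in_Hom[OF assms] right_unitor_in_Hom[OF assms] by (auto simp: Hom_iff)

lemma tensor_comp_arr:
  assumes "f \<in> Arr C" "f' \<in> Arr C" "g \<in> Arr C" "g' \<in> Arr C"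
    "Dom C f' = Cod C f" "Dom C g' = Cod C g"
  shows "(f' \<boxtimes> g') \<cdot> (f \<boxtimes> g) = (f' \<cdot> f) \<boxtimes> (g' \<cdot> g)"
  using interchange[of f _ _ f' _ g _ _ g'] assms by (auto simp: Hom_iff)

lemma tensor_comp_arr_tail:
  assumes "f \<in> Arr C" "f' \<in> Arr C" "g \<in> Arr C" "g' \<in> Arr C" "h \<in> Arr C"
    "Dom C f' = Cod C f" "Dom C g' = Cod C g" "Cod C h = Dom C f \<otimes> Dom C g"
  shows "(f' \<boxtimes> g') \<cdot> ((f \<boxtimes> g) \<cdot> h) = ((f' \<cdot> f) \<boxtimes> (g' \<cdot> g)) \<cdot> h"
  using assms comp_assoc_arr[of h "f \<boxtimes> g" "f' \<boxtimes> g'"] by (simp add: tensor_arr tensor_comp_arr)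

text \<open>Composites are normalized to the right, and adjacent tensor products of arrows are fused.
  Naturality and the monoid laws are left out: their direction depends on the argument.\<close>

lemmas monoidal_simps = arr_simps tensor_obj_in_Obj unit_in_Obj tensor_arr associator_arr unitor_arr
  tensor_idt tensor_comp_arr tensor_comp_arr_tail

lemma tensor_idt_iso:
  assumes "is_iso C f" "Z \<in> Obj C"
  shows "is_iso C (f \<boxtimes> \<one> Z)"
proof -
  obtain A B g where "f \<in> Hom C A B" "g \<in> Hom C B A" "g \<cdot> f = \<one> A" "f \<cdot> g = \<one> B"
    using assms(1) unfolding is_iso_def by blast
  moreover from this have "A \<in> Obj C" "B \<in> Obj C" using HomD by blast+
  ultimately show ?thesis
    unfolding is_iso_def using assms(2)
    by (intro exI[of _ "A \<otimes> Z"] exI[of _ "B \<otimes> Z"] exI[of _ "g \<boxtimes> \<one> Z"])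
       (auto simp: monoidal_simps)
qed

lemma associator_natural_arr:
  assumes "f \<in> Arr C" "g \<in> Arr C" "h \<in> Arr C"
  shows "\<alpha> (Cod C f) (Cod C g) (Cod C h) \<cdot> ((f \<boxtimes> g) \<boxtimes> h) =
    (f \<boxtimes> (g \<boxtimes> h)) \<cdot> \<alpha> (Dom C f) (Dom C g) (Dom C h)"
  using associator_natural assms by (simp add: Hom_iff)

end

locale coequalizer_preserving_tensor = monoidal_category C
  for C :: "('o, 'm, 'x) monoidal_data_scheme" (structure) +
  assumes tensor_preserves: "tensor_preserves_coequalizers C"
begin

lemma coequalizer_tensor:
  assumes "is_coequalizer C f g q" "Z \<in> Obj C"
  shows "is_coequalizer C (\<one> Z \<boxtimes> f) (\<one> Z \<boxtimes> g) (\<one> Z \<boxtimes> q)"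
    and "is_coequalizer C (f \<boxtimes> \<one> Z) (g \<boxtimes> \<one> Z) (q \<boxtimes> \<one> Z)"
  using tensor_preserves assms
  unfolding tensor_preserves_coequalizers_def preserves_coequalizers_def
  by (auto simp: tensor_left_def tensor_right_def)

text \<open>The arrow is \<open>(q \<otimes> 1) \<sqdot> (1 \<otimes> q')\<close>, a composite of two coequalizers.\<close>

lemma coequalizer_tensor_epic:
  assumes q: "is_coequalizer C f g q" and q': "is_coequalizer C f' g' q'"
  shows "epic C (q \<boxtimes> q')"
proof -
  note qs = coequalizer_arr[OF q] coequalizer_arr[OF q']
  have "epic C ((q \<boxtimes> \<one> (Cod C q')) \<cdot> (\<one> (Dom C q) \<boxtimes> q'))"
    by (intro epic_comp coequalizer_epic[OF coequalizer_tensor(2)[OF q]]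
          coequalizer_epic[OF coequalizer_tensor(1)[OF q']])
       (use qs in \<open>simp_all add: monoidal_simps\<close>)
  then show ?thesis using qs by (simp add: monoidal_simps)
qed

lemma coequalizer_tensor3_epic:
  assumes q: "is_coequalizer C f g q"
  shows "epic C ((q \<boxtimes> q) \<boxtimes> q)"
proof -
  note qs = coequalizer_arr[OF q]
  have "epic C (((q \<boxtimes> \<one> (Cod C q)) \<boxtimes> \<one> (Cod C q)) \<cdot> ((\<one> (Dom C q) \<boxtimes> q) \<boxtimes> q))"
  proof (rule epic_comp)
    show "epic C ((q \<boxtimes> \<one> (Cod C q)) \<boxtimes> \<one> (Cod C q))"
      by (rule coequalizer_epic[OF coequalizer_tensor(2)[OF coequalizer_tensor(2)[OF q]]])
         (use qs in \<open>simp_all add: monoidal_simps\<close>)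
    show "epic C ((\<one> (Dom C q) \<boxtimes> q) \<boxtimes> q)"
      by (intro coequalizer_tensor_epic[OF coequalizer_tensor(1)[OF q] q])
         (use qs in \<open>simp_all add: monoidal_simps\<close>)
  qed (use qs in \<open>simp_all add: monoidal_simps\<close>)
  then show ?thesis using qs by (simp add: monoidal_simps)
qed

end

section \<open>Quotient monoids\<close>

context monoidal_category
begin

lemma monoidD:
  assumes "is_monoid C (B, m, e)"
  shows "B \<in> Obj C" "m \<in> Arr C" "Dom C m = B \<otimes> B" "Cod C m = B"
    "e \<in> Arr C" "Dom C e = \<I>" "Cod C e = B"
    "m \<cdot> (m \<boxtimes> \<one> B) = m \<cdot> ((\<one> B \<boxtimes> m) \<cdot> \<alpha> B B B)"
    "m \<cdot> (e \<boxtimes> \<one> B) = \<ll> B" "m \<cdot> (\<one> B \<boxtimes> e) = \<rho> B"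
proof -
  show t: "B \<in> Obj C" "m \<in> Arr C" "Dom C m = B \<otimes> B" "Cod C m = B"
    "e \<in> Arr C" "Dom C e = \<I>" "Cod C e = B"
    using assms by (auto simp: is_monoid_def Hom_iff)
  show "m \<cdot> (m \<boxtimes> \<one> B) = m \<cdot> ((\<one> B \<boxtimes> m) \<cdot> \<alpha> B B B)"
    "m \<cdot> (e \<boxtimes> \<one> B) = \<ll> B" "m \<cdot> (\<one> B \<boxtimes> e) = \<rho> B"
    using assms t by (auto simp: is_monoid_def monoidal_simps)
qed

lemma morphismD:
  assumes "is_monoid_morphism C (B, m, e) h (Z, n, z)"
  shows "h \<in> Arr C" "Dom C h = B" "Cod C h = Z" "h \<cdot> m = n \<cdot> (h \<boxtimes> h)" "h \<cdot> e = z"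
  using assms by (auto simp: is_monoid_morphism_def Hom_iff)

text \<open>The morphism law for \<open>k\<close> holds after precomposition with \<open>q \<otimes> q\<close>. This is used for quotients,
  to see that induced arrows are morphisms, and for the counits of the free monoids, which are split epi
  in \<open>C\<close>.\<close>

lemma monoid_morphism_cancel_epic:
  assumes B: "is_monoid C (B, m, e)" and Q: "is_monoid C (Q, m', e')" and Z: "is_monoid C (Z, n, z)"
    and q: "is_monoid_morphism C (B, m, e) q (Q, m', e')"
    and h: "is_monoid_morphism C (B, m, e) h (Z, n, z)"
    and qq: "epic C (q \<boxtimes> q)"
    and k: "k \<in> Hom C Q Z" "k \<cdot> q = h"
  shows "is_monoid_morphism C (Q, m', e') k (Z, n, z)"
proof -
  note ts = monoidD(1-7)[OF B] monoidD(1-7)[OF Q] monoidD(1-7)[OF Z] morphismD(1-3)[OF q]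
  have ka: "k \<in> Arr C" "Dom C k = Q" "Cod C k = Z" using k by (auto simp: Hom_iff)
  have "(k \<cdot> m') \<cdot> (q \<boxtimes> q) = k \<cdot> (q \<cdot> m)"
    using ts ka morphismD(4)[OF q] by (simp add: monoidal_simps)
  also have "\<dots> = h \<cdot> m"
    unfolding k(2)[symmetric] using ts ka by (simp add: monoidal_simps)
  also have "\<dots> = (n \<cdot> (k \<boxtimes> k)) \<cdot> (q \<boxtimes> q)"
    using ts ka k(2) morphismD(4)[OF h] by (simp add: monoidal_simps)
  finally have "k \<cdot> m' = n \<cdot> (k \<boxtimes> k)"
    using epic_cancel[OF qq, of "k \<cdot> m'" "n \<cdot> (k \<boxtimes> k)"] ts ka by (simp add: monoidal_simps)
  moreover have "k \<cdot> e' = z"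
  proof -
    have "k \<cdot> e' = k \<cdot> (q \<cdot> e)" using morphismD(5)[OF q] by simp
    also have "\<dots> = (k \<cdot> q) \<cdot> e" using ts ka by (simp add: comp_assoc_arr)
    finally show ?thesis using k(2) morphismD(5)[OF h] by simp
  qed
  ultimately show ?thesis using ka by (simp add: is_monoid_morphism_def Hom_iff)
qed

end

context coequalizer_preserving_tensor
begin

text \<open>The hypotheses say that the relation \<open>u \<sim> v\<close> survives multiplication from either side. By the
  first the multiplication factors through \<open>q \<otimes> 1 : B \<otimes> B \<rightarrow> Q \<otimes> B\<close>; by the second the resulting
  right action of \<open>B\<close> on \<open>Q\<close> factors through \<open>1 \<otimes> q : Q \<otimes> B \<rightarrow> Q \<otimes> Q\<close>. The monoid laws of \<open>Q\<close> are
  those of \<open>B\<close> after cancelling \<open>(q \<otimes> q) \<otimes> q\<close>, \<open>1 \<otimes> q\<close> and \<open>q \<otimes> 1\<close>.\<close>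

lemma quotient_monoid:
  assumes B: "is_monoid C (B, m, e)" and q: "is_coequalizer C u v q" and cod: "Cod C u = B"
    and right: "q \<cdot> (m \<cdot> (u \<boxtimes> \<one> B)) = q \<cdot> (m \<cdot> (v \<boxtimes> \<one> B))"
    and left: "q \<cdot> (m \<cdot> (\<one> B \<boxtimes> u)) = q \<cdot> (m \<cdot> (\<one> B \<boxtimes> v))"
  obtains R where "is_monoid C R" "is_monoid_morphism C (B, m, e) q R"
    "\<And>Z h. \<lbrakk>is_monoid C Z; is_monoid_morphism C (B, m, e) h Z; h \<cdot> u = h \<cdot> v\<rbrakk> \<Longrightarrow>
      \<exists>!k. is_monoid_morphism C R k Z \<and> k \<cdot> q = h"
proof -
  note bt = monoidD(1-7)[OF B]
  define Q where "Q = Cod C q"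
  have qt: "u \<in> Arr C" "v \<in> Arr C" "q \<in> Arr C" "Dom C v = Dom C u" "Cod C u = B" "Cod C v = B"
    "Dom C q = B" "Cod C q = Q" and Q: "Q \<in> Obj C"
    using coequalizer_arr[OF q] cod by (auto simp: Q_def cod_in_Obj)
  note ts = bt qt Q
  obtain n where "n \<in> Hom C (Q \<otimes> B) Q" and nq: "n \<cdot> (q \<boxtimes> \<one> B) = q \<cdot> m"
    by (rule coequalizer_factor[OF coequalizer_tensor(2)[OF q, of B], of "q \<cdot> m"])
       (use ts right in \<open>simp_all add: monoidal_simps\<close>)
  then have nt: "n \<in> Arr C" "Dom C n = Q \<otimes> B" "Cod C n = Q" by (auto simp: Hom_iff)
  \<comment> \<open>The relation in the second factor is inherited from \<open>B \<otimes> B\<close>, because \<open>q \<otimes> 1\<close> is epi.\<close>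
  have nuv: "n \<cdot> (\<one> Q \<boxtimes> u) = n \<cdot> (\<one> Q \<boxtimes> v)"
  proof (rule epic_cancel[OF coequalizer_epic[OF coequalizer_tensor(2)[OF q, of "Dom C u"]]])
    have *: "(n \<cdot> (\<one> Q \<boxtimes> w)) \<cdot> (q \<boxtimes> \<one> (Dom C u)) = q \<cdot> (m \<cdot> (\<one> B \<boxtimes> w))"
      if "w \<in> Arr C" "Dom C w = Dom C u" "Cod C w = B" for w
    proof -
      have "(n \<cdot> (\<one> Q \<boxtimes> w)) \<cdot> (q \<boxtimes> \<one> (Dom C u)) = (n \<cdot> (q \<boxtimes> \<one> B)) \<cdot> (\<one> B \<boxtimes> w)"
        using ts nt that by (simp add: monoidal_simps)
      also have "\<dots> = q \<cdot> (m \<cdot> (\<one> B \<boxtimes> w))"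
        unfolding nq using ts that by (simp add: monoidal_simps)
      finally show ?thesis .
    qed
    show "(n \<cdot> (\<one> Q \<boxtimes> u)) \<cdot> (q \<boxtimes> \<one> (Dom C u)) = (n \<cdot> (\<one> Q \<boxtimes> v)) \<cdot> (q \<boxtimes> \<one> (Dom C u))"
      using *[of u] *[of v] left qt by simp
  qed (use ts nt in \<open>simp_all add: monoidal_simps\<close>)
  obtain \<mu> where "\<mu> \<in> Hom C (Q \<otimes> Q) Q" and \<mu>q: "\<mu> \<cdot> (\<one> Q \<boxtimes> q) = n"
    by (rule coequalizer_factor[OF coequalizer_tensor(1)[OF q, of Q], of n])
       (use ts nt nuv in \<open>simp_all add: monoidal_simps\<close>)
  then have mt: "\<mu> \<in> Arr C" "Dom C \<mu> = Q \<otimes> Q" "Cod C \<mu> = Q" by (auto simp: Hom_iff)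
  note ts = ts nt mt
  have \<mu>qq: "\<mu> \<cdot> (q \<boxtimes> q) = q \<cdot> m"
    unfolding nq[symmetric] \<mu>q[symmetric] using ts by (simp add: monoidal_simps)
  \<comment> \<open>A product of classes is the class of the product, for generalized elements \<open>a\<close> and \<open>b\<close> of \<open>B\<close>.\<close>
  have qme: "\<mu> \<cdot> ((q \<cdot> a) \<boxtimes> (q \<cdot> b)) = q \<cdot> (m \<cdot> (a \<boxtimes> b))"
    if "a \<in> Arr C" "b \<in> Arr C" "Cod C a = B" "Cod C b = B" for a b
  proof -
    have "\<mu> \<cdot> ((q \<cdot> a) \<boxtimes> (q \<cdot> b)) = (\<mu> \<cdot> (q \<boxtimes> q)) \<cdot> (a \<boxtimes> b)"
      using ts that by (simp add: monoidal_simps)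
    also have "\<dots> = q \<cdot> (m \<cdot> (a \<boxtimes> b))"
      unfolding \<mu>qq using ts that by (simp add: monoidal_simps)
    finally show ?thesis .
  qed
  have assoc: "\<mu> \<cdot> (\<mu> \<boxtimes> \<one> Q) = (\<mu> \<cdot> (\<one> Q \<boxtimes> \<mu>)) \<cdot> \<alpha> Q Q Q"
  proof (rule epic_cancel[OF coequalizer_tensor3_epic[OF q]])
    have "(\<mu> \<cdot> (\<mu> \<boxtimes> \<one> Q)) \<cdot> ((q \<boxtimes> q) \<boxtimes> q) = \<mu> \<cdot> ((q \<cdot> m) \<boxtimes> (q \<cdot> \<one> B))"
      using ts \<mu>qq by (simp add: monoidal_simps)
    also have "\<dots> = q \<cdot> (m \<cdot> (m \<boxtimes> \<one> B))"
      by (rule qme) (use ts in \<open>simp_all add: monoidal_simps\<close>)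
    also have "\<dots> = (q \<cdot> (m \<cdot> (\<one> B \<boxtimes> m))) \<cdot> \<alpha> B B B"
      unfolding monoidD(8)[OF B] using ts by (simp add: monoidal_simps)
    also have "q \<cdot> (m \<cdot> (\<one> B \<boxtimes> m)) = \<mu> \<cdot> ((q \<cdot> \<one> B) \<boxtimes> (q \<cdot> m))"
      by (rule qme[symmetric]) (use ts in \<open>simp_all add: monoidal_simps\<close>)
    also have "\<dots> = \<mu> \<cdot> ((\<one> Q \<boxtimes> \<mu>) \<cdot> (q \<boxtimes> (q \<boxtimes> q)))"
      using ts \<mu>qq by (simp add: monoidal_simps)
    also have "\<dots> \<cdot> \<alpha> B B B = \<mu> \<cdot> ((\<one> Q \<boxtimes> \<mu>) \<cdot> ((q \<boxtimes> (q \<boxtimes> q)) \<cdot> \<alpha> B B B))"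
      using ts by (simp add: monoidal_simps)
    also have "(q \<boxtimes> (q \<boxtimes> q)) \<cdot> \<alpha> B B B = \<alpha> Q Q Q \<cdot> ((q \<boxtimes> q) \<boxtimes> q)"
      using associator_natural_arr[of q q q] ts by simp
    finally show "(\<mu> \<cdot> (\<mu> \<boxtimes> \<one> Q)) \<cdot> ((q \<boxtimes> q) \<boxtimes> q) =
        ((\<mu> \<cdot> (\<one> Q \<boxtimes> \<mu>)) \<cdot> \<alpha> Q Q Q) \<cdot> ((q \<boxtimes> q) \<boxtimes> q)"
      using ts by (simp add: monoidal_simps)
  qed (use ts in \<open>simp_all add: monoidal_simps\<close>)
  have lunit: "\<mu> \<cdot> ((q \<cdot> e) \<boxtimes> \<one> Q) = \<ll> Q"
  proof (rule epic_cancel[OF coequalizer_epic[OF coequalizer_tensor(1)[OF q unit_in_Obj]]])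
    have "(\<mu> \<cdot> ((q \<cdot> e) \<boxtimes> \<one> Q)) \<cdot> (\<one> \<I> \<boxtimes> q) = \<mu> \<cdot> ((q \<cdot> e) \<boxtimes> (q \<cdot> \<one> B))"
      using ts by (simp add: monoidal_simps)
    also have "\<dots> = q \<cdot> (m \<cdot> (e \<boxtimes> \<one> B))"
      by (rule qme) (use ts in \<open>simp_all add: monoidal_simps\<close>)
    also have "\<dots> = \<ll> Q \<cdot> (\<one> \<I> \<boxtimes> q)"
      unfolding monoidD(9)[OF B] using left_unitor_natural[of q B Q] ts by (simp add: Hom_iff)
    finally show "(\<mu> \<cdot> ((q \<cdot> e) \<boxtimes> \<one> Q)) \<cdot> (\<one> \<I> \<boxtimes> q) = \<ll> Q \<cdot> (\<one> \<I> \<boxtimes> q)" .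
  qed (use ts in \<open>simp_all add: monoidal_simps\<close>)
  have runit: "\<mu> \<cdot> (\<one> Q \<boxtimes> (q \<cdot> e)) = \<rho> Q"
  proof (rule epic_cancel[OF coequalizer_epic[OF coequalizer_tensor(2)[OF q unit_in_Obj]]])
    have "(\<mu> \<cdot> (\<one> Q \<boxtimes> (q \<cdot> e))) \<cdot> (q \<boxtimes> \<one> \<I>) = \<mu> \<cdot> ((q \<cdot> \<one> B) \<boxtimes> (q \<cdot> e))"
      using ts by (simp add: monoidal_simps)
    also have "\<dots> = q \<cdot> (m \<cdot> (\<one> B \<boxtimes> e))"
      by (rule qme) (use ts in \<open>simp_all add: monoidal_simps\<close>)
    also have "\<dots> = \<rho> Q \<cdot> (q \<boxtimes> \<one> \<I>)"
      unfolding monoidD(10)[OF B] using right_unitor_natural[of q B Q] ts by (simp add: Hom_iff)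
    finally show "(\<mu> \<cdot> (\<one> Q \<boxtimes> (q \<cdot> e))) \<cdot> (q \<boxtimes> \<one> \<I>) = \<rho> Q \<cdot> (q \<boxtimes> \<one> \<I>)" .
  qed (use ts in \<open>simp_all add: monoidal_simps\<close>)
  have R: "is_monoid C (Q, \<mu>, q \<cdot> e)"
    using ts assoc lunit runit by (simp add: is_monoid_def arr_simps)
  have qm: "is_monoid_morphism C (B, m, e) q (Q, \<mu>, q \<cdot> e)"
    using ts \<mu>qq by (simp add: is_monoid_morphism_def Hom_iff)
  show ?thesis
  proof (rule that[OF R qm])
    fix Z h
    assume Z: "is_monoid C Z" and h: "is_monoid_morphism C (B, m, e) h Z" and uv: "h \<cdot> u = h \<cdot> v"
    obtain Z' n' z' where Zt: "Z = (Z', n', z')" by (cases Z)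
    note ht = morphismD(1-3)[OF h[unfolded Zt]]
    obtain k where k: "k \<in> Hom C Q Z'" "k \<cdot> q = h"
      by (rule coequalizer_factor[OF q, of h]) (use ts ht uv in simp_all)
    show "\<exists>!k. is_monoid_morphism C (Q, \<mu>, q \<cdot> e) k Z \<and> k \<cdot> q = h"
    proof (rule ex1I[of _ k])
      show "is_monoid_morphism C (Q, \<mu>, q \<cdot> e) k Z \<and> k \<cdot> q = h"
        using monoid_morphism_cancel_epic[OF B R Z[unfolded Zt] qm h[unfolded Zt]
            coequalizer_tensor_epic[OF q q] k] k(2) Zt by simp
      fix k' assume "is_monoid_morphism C (Q, \<mu>, q \<cdot> e) k' Z \<and> k' \<cdot> q = h"
      then show "k' = k"
        using epic_cancel[OF coequalizer_epic[OF q], of k' k] k ts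
        by (auto simp: Zt Hom_iff dest: morphismD)
    qed
  qed
qed

end

context monoidal_category
begin

text \<open>On elements this is \<open>(b, a, b') \<mapsto> (b \<sqdot> f a) \<sqdot> b'\<close>; its values generate the two-sided ideal of the
  image of \<open>f\<close>.\<close>

definition ideal_action :: "'o \<Rightarrow> 'm \<Rightarrow> 'm \<Rightarrow> 'm"
  where "ideal_action B m f = m \<cdot> ((m \<cdot> (\<one> B \<boxtimes> f)) \<boxtimes> \<one> B)"

lemma ideal_action_arr:
  assumes "is_monoid C (B, m, e)" "f \<in> Hom C A B"
  shows "ideal_action B m f \<in> Hom C ((B \<otimes> A) \<otimes> B) B"
  using monoidD(1-7)[OF assms(1)] assms(2) HomD[OF assms(2)]
  by (auto simp: ideal_action_def monoidal_simps)

text \<open>On elements: \<open>((b \<sqdot> f a) \<sqdot> b') \<sqdot> b'' = (b \<sqdot> f a) \<sqdot> (b' \<sqdot> b'')\<close>.\<close>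

lemma ideal_action_right_linear:
  assumes B: "is_monoid C (B, m, e)" and f: "f \<in> Hom C A B"
  shows "m \<cdot> (ideal_action B m f \<boxtimes> \<one> B) =
    ideal_action B m f \<cdot> ((\<one> (B \<otimes> A) \<boxtimes> m) \<cdot> \<alpha> (B \<otimes> A) B B)"
proof -
  define x where "x = m \<cdot> (\<one> B \<boxtimes> f)"
  have t: "f \<in> Arr C" "Dom C f = A" "Cod C f = B" "A \<in> Obj C"
    using f HomD[OF f] by (auto simp: Hom_iff)
  note ts = t monoidD(1-7)[OF B]
  have xt: "x \<in> Arr C" "Dom C x = B \<otimes> A" "Cod C x = B"
    using ts by (auto simp: x_def monoidal_simps)
  have "m \<cdot> ((m \<cdot> (x \<boxtimes> \<one> B)) \<boxtimes> \<one> B) = (m \<cdot> (m \<boxtimes> \<one> B)) \<cdot> ((x \<boxtimes> \<one> B) \<boxtimes> \<one> B)"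
    using ts xt by (simp add: monoidal_simps)
  also have "\<dots> = m \<cdot> ((\<one> B \<boxtimes> m) \<cdot> (\<alpha> B B B \<cdot> ((x \<boxtimes> \<one> B) \<boxtimes> \<one> B)))"
    unfolding monoidD(8)[OF B] using ts xt by (simp add: monoidal_simps)
  also have "\<alpha> B B B \<cdot> ((x \<boxtimes> \<one> B) \<boxtimes> \<one> B) = (x \<boxtimes> (\<one> B \<boxtimes> \<one> B)) \<cdot> \<alpha> (B \<otimes> A) B B"
    using associator_natural_arr[of x "\<one> B" "\<one> B"] ts xt by (simp add: idt_arr)
  finally show ?thesis
    unfolding ideal_action_def x_def[symmetric] using ts xt by (simp add: monoidal_simps)
qed

text \<open>On elements: \<open>b \<sqdot> ((b' \<sqdot> f a) \<sqdot> b'') = ((b \<sqdot> b') \<sqdot> f a) \<sqdot> b''\<close>. The associators are put on the left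
  side of the equation; being epi they can be cancelled where the lemma is applied, and their inverses
  do not occur.\<close>

lemma ideal_action_left_linear:
  assumes B: "is_monoid C (B, m, e)" and f: "f \<in> Hom C A B"
  shows "(m \<cdot> (\<one> B \<boxtimes> ideal_action B m f)) \<cdot> (\<alpha> B (B \<otimes> A) B \<cdot> (\<alpha> B B A \<boxtimes> \<one> B)) =
    ideal_action B m f \<cdot> ((m \<boxtimes> \<one> A) \<boxtimes> \<one> B)"
proof -
  define x where "x = m \<cdot> (\<one> B \<boxtimes> f)"
  have t: "f \<in> Arr C" "Dom C f = A" "Cod C f = B" "A \<in> Obj C"
    using f HomD[OF f] by (auto simp: Hom_iff)
  note ts = t monoidD(1-7)[OF B]
  have xt: "x \<in> Arr C" "Dom C x = B \<otimes> A" "Cod C x = B"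
    using ts by (auto simp: x_def monoidal_simps)
  have "m \<cdot> ((\<one> B \<boxtimes> x) \<cdot> \<alpha> B B A) = m \<cdot> ((\<one> B \<boxtimes> m) \<cdot> ((\<one> B \<boxtimes> (\<one> B \<boxtimes> f)) \<cdot> \<alpha> B B A))"
    unfolding x_def using ts by (simp add: monoidal_simps)
  also have "(\<one> B \<boxtimes> (\<one> B \<boxtimes> f)) \<cdot> \<alpha> B B A = \<alpha> B B B \<cdot> ((\<one> B \<boxtimes> \<one> B) \<boxtimes> f)"
    using associator_natural_arr[of "\<one> B" "\<one> B" f] ts by (simp add: idt_arr)
  also have "m \<cdot> ((\<one> B \<boxtimes> m) \<cdot> (\<alpha> B B B \<cdot> ((\<one> B \<boxtimes> \<one> B) \<boxtimes> f))) =
      (m \<cdot> ((\<one> B \<boxtimes> m) \<cdot> \<alpha> B B B)) \<cdot> (\<one> (B \<otimes> B) \<boxtimes> f)"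
    using ts by (simp add: monoidal_simps)
  also have "\<dots> = x \<cdot> (m \<boxtimes> \<one> A)"
    unfolding monoidD(8)[OF B, symmetric] x_def using ts by (simp add: monoidal_simps)
  finally have x_linear: "m \<cdot> ((\<one> B \<boxtimes> x) \<cdot> \<alpha> B B A) = x \<cdot> (m \<boxtimes> \<one> A)" .
  have "(m \<cdot> (\<one> B \<boxtimes> (m \<cdot> (x \<boxtimes> \<one> B)))) \<cdot> (\<alpha> B (B \<otimes> A) B \<cdot> (\<alpha> B B A \<boxtimes> \<one> B)) =
      m \<cdot> ((\<one> B \<boxtimes> m) \<cdot> (((\<one> B \<boxtimes> (x \<boxtimes> \<one> B)) \<cdot> \<alpha> B (B \<otimes> A) B) \<cdot> (\<alpha> B B A \<boxtimes> \<one> B)))"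
    using ts xt by (simp add: monoidal_simps)
  also have "(\<one> B \<boxtimes> (x \<boxtimes> \<one> B)) \<cdot> \<alpha> B (B \<otimes> A) B = \<alpha> B B B \<cdot> ((\<one> B \<boxtimes> x) \<boxtimes> \<one> B)"
    using associator_natural_arr[of "\<one> B" x "\<one> B"] ts xt by (simp add: idt_arr)
  also have "m \<cdot> ((\<one> B \<boxtimes> m) \<cdot> ((\<alpha> B B B \<cdot> ((\<one> B \<boxtimes> x) \<boxtimes> \<one> B)) \<cdot> (\<alpha> B B A \<boxtimes> \<one> B))) =
      (m \<cdot> ((\<one> B \<boxtimes> m) \<cdot> \<alpha> B B B)) \<cdot> (((\<one> B \<boxtimes> x) \<cdot> \<alpha> B B A) \<boxtimes> \<one> B)"
    using ts xt by (simp add: monoidal_simps)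
  also have "\<dots> = m \<cdot> ((m \<cdot> ((\<one> B \<boxtimes> x) \<cdot> \<alpha> B B A)) \<boxtimes> \<one> B)"
    unfolding monoidD(8)[OF B, symmetric] using ts xt by (simp add: monoidal_simps)
  also have "\<dots> = m \<cdot> ((x \<boxtimes> \<one> B) \<cdot> ((m \<boxtimes> \<one> A) \<boxtimes> \<one> B))"
    unfolding x_linear using ts xt by (simp add: monoidal_simps)
  finally show ?thesis
    unfolding ideal_action_def x_def[symmetric] using ts xt by (simp add: monoidal_simps)
qed

text \<open>On elements: \<open>(1 \<sqdot> f a) \<sqdot> 1 = f a\<close>.\<close>

lemma ideal_action_units:
  assumes B: "is_monoid C (B, m, e)" and f: "f \<in> Hom C A B"
  shows "ideal_action B m f \<cdot> ((e \<boxtimes> \<one> A) \<boxtimes> e) = f \<cdot> (\<ll> A \<cdot> \<rho> (\<I> \<otimes> A))"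
proof -
  have t: "f \<in> Arr C" "Dom C f = A" "Cod C f = B" "A \<in> Obj C"
    using f HomD[OF f] by (auto simp: Hom_iff)
  note ts = t monoidD(1-7)[OF B]
  have "m \<cdot> (e \<boxtimes> f) = (m \<cdot> (e \<boxtimes> \<one> B)) \<cdot> (\<one> \<I> \<boxtimes> f)"
    using ts by (simp add: monoidal_simps)
  also have "\<dots> = f \<cdot> \<ll> A"
    unfolding monoidD(9)[OF B] using left_unitor_natural[OF f] .
  finally have fl: "m \<cdot> (e \<boxtimes> f) = f \<cdot> \<ll> A" .
  have "ideal_action B m f \<cdot> ((e \<boxtimes> \<one> A) \<boxtimes> e) = m \<cdot> ((m \<cdot> (e \<boxtimes> f)) \<boxtimes> e)"
    unfolding ideal_action_def using ts by (simp add: monoidal_simps)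
  also have "\<dots> = (m \<cdot> (\<one> B \<boxtimes> e)) \<cdot> ((f \<cdot> \<ll> A) \<boxtimes> \<one> \<I>)"
    unfolding fl using ts by (simp add: monoidal_simps)
  also have "\<dots> = (f \<cdot> \<ll> A) \<cdot> \<rho> (\<I> \<otimes> A)"
    unfolding monoidD(10)[OF B]
    by (rule right_unitor_natural) (use ts in \<open>simp add: monoidal_simps\<close>)
  finally show ?thesis using ts by (simp add: monoidal_simps)
qed

text \<open>The right side contains \<open>f\<close> only through \<open>h \<sqdot> f\<close>. Hence \<open>h\<close> identifies the actions of \<open>f\<close> and \<open>g\<close> as
  soon as it identifies \<open>f\<close> and \<open>g\<close>.\<close>

lemma morphism_ideal_action:
  assumes B: "is_monoid C (B, m, e)" and f: "f \<in> Hom C A B" and Z: "is_monoid C (Z, n, z)"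
    and h: "is_monoid_morphism C (B, m, e) h (Z, n, z)"
  shows "h \<cdot> ideal_action B m f = n \<cdot> ((n \<cdot> (h \<boxtimes> (h \<cdot> f))) \<boxtimes> h)"
proof -
  have t: "f \<in> Arr C" "Dom C f = A" "Cod C f = B" "A \<in> Obj C"
    using f HomD[OF f] by (auto simp: Hom_iff)
  note ts = t monoidD(1-7)[OF B] monoidD(1-7)[OF Z] morphismD(1-3)[OF h]
  define x where "x = m \<cdot> (\<one> B \<boxtimes> f)"
  have xt: "x \<in> Arr C" "Dom C x = B \<otimes> A" "Cod C x = B"
    using ts by (auto simp: x_def monoidal_simps)
  have "h \<cdot> x = (h \<cdot> m) \<cdot> (\<one> B \<boxtimes> f)"
    unfolding x_def using ts by (simp add: monoidal_simps)
  also have "\<dots> = n \<cdot> (h \<boxtimes> (h \<cdot> f))"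
    unfolding morphismD(4)[OF h] using ts by (simp add: monoidal_simps)
  finally have hx: "h \<cdot> x = n \<cdot> (h \<boxtimes> (h \<cdot> f))" .
  have "h \<cdot> ideal_action B m f = (h \<cdot> m) \<cdot> (x \<boxtimes> \<one> B)"
    unfolding ideal_action_def x_def[symmetric] using ts xt by (simp add: monoidal_simps)
  also have "\<dots> = n \<cdot> ((h \<cdot> x) \<boxtimes> h)"
    unfolding morphismD(4)[OF h] using ts xt by (simp add: monoidal_simps)
  also have "\<dots> = n \<cdot> ((n \<cdot> (h \<boxtimes> (h \<cdot> f))) \<boxtimes> h)"
    unfolding hx ..
  finally show ?thesis .
qed

end

context coequalizer_preserving_tensor
begin

theorem has_coequalizers_Mon:
  assumes coeq: "has_coequalizers C"
  shows "has_coequalizers (Mon C)"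
  unfolding has_coequalizers_def
proof (intro allI ballI)
  fix A B F G
  assume F: "F \<in> Hom (Mon C) A B" and G: "G \<in> Hom (Mon C) A B"
  obtain f g where FG: "F = (A, f, B)" "G = (A, g, B)"
    and A: "is_monoid C A" and B: "is_monoid C B"
    and f: "is_monoid_morphism C A f B" and g: "is_monoid_morphism C A g B"
    using F G by (auto simp: Hom_Mon)
  obtain B' m e where Bt: "B = (B', m, e)" by (cases B)
  define A' where "A' = fst A"
  have fg: "f \<in> Hom C A' B'" "g \<in> Hom C A' B'"
    using monoid_morphism_Hom[OF f] monoid_morphism_Hom[OF g] by (auto simp: A'_def Bt)
  note B' = B[unfolded Bt]
  define u where "u = ideal_action B' m f"
  define v where "v = ideal_action B' m g"
  have uv: "u \<in> Hom C ((B' \<otimes> A') \<otimes> B') B'" "v \<in> Hom C ((B' \<otimes> A') \<otimes> B') B'"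
    using ideal_action_arr[OF B'] fg by (auto simp: u_def v_def)
  then obtain q where q: "is_coequalizer C u v q"
    using coeq unfolding has_coequalizers_def by blast
  note qt = coequalizer_arr[OF q]
  have AB: "A' \<in> Obj C" "B' \<in> Obj C" using HomD[OF fg(1)] by auto
  note ts = monoidD(1-7)[OF B'] fg[unfolded Hom_iff] uv[unfolded Hom_iff] qt(3,6) AB
  \<comment> \<open>Linearity moves the extra factor inside the action, where \<open>q\<close> identifies \<open>u\<close> and \<open>v\<close>.\<close>
  have right: "q \<cdot> (m \<cdot> (u \<boxtimes> \<one> B')) = q \<cdot> (m \<cdot> (v \<boxtimes> \<one> B'))"
  proof -
    have *: "q \<cdot> (w \<cdot> ((\<one> (B' \<otimes> A') \<boxtimes> m) \<cdot> \<alpha> (B' \<otimes> A') B' B')) =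
        (q \<cdot> w) \<cdot> ((\<one> (B' \<otimes> A') \<boxtimes> m) \<cdot> \<alpha> (B' \<otimes> A') B' B')"
      if "w \<in> Hom C ((B' \<otimes> A') \<otimes> B') B'" for w
      using ts that by (simp add: monoidal_simps)
    show ?thesis
      unfolding u_def v_def ideal_action_right_linear[OF B' fg(1)]
        ideal_action_right_linear[OF B' fg(2)]
      unfolding u_def[symmetric] v_def[symmetric] *[OF uv(1)] *[OF uv(2)] qt(7) ..
  qed
  have left: "q \<cdot> (m \<cdot> (\<one> B' \<boxtimes> u)) = q \<cdot> (m \<cdot> (\<one> B' \<boxtimes> v))"
  proof -
    define a where "a = \<alpha> B' (B' \<otimes> A') B' \<cdot> (\<alpha> B' B' A' \<boxtimes> \<one> B')"
    have a: "epic C a"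
      unfolding a_def by (intro epic_comp iso_epic tensor_idt_iso associator_iso)
        (use AB in \<open>simp_all add: monoidal_simps\<close>)
    have at: "a \<in> Arr C" "Cod C a = B' \<otimes> ((B' \<otimes> A') \<otimes> B')"
      using AB by (auto simp: a_def monoidal_simps)
    have *: "(q \<cdot> (m \<cdot> (\<one> B' \<boxtimes> ideal_action B' m k))) \<cdot> a =
        (q \<cdot> ideal_action B' m k) \<cdot> ((m \<boxtimes> \<one> A') \<boxtimes> \<one> B')" if k: "k \<in> Hom C A' B'" for k
    proof -
      note kt = ideal_action_arr[OF B' k, unfolded Hom_iff]
      have "(q \<cdot> (m \<cdot> (\<one> B' \<boxtimes> ideal_action B' m k))) \<cdot> a =
          q \<cdot> ((m \<cdot> (\<one> B' \<boxtimes> ideal_action B' m k)) \<cdot> a)"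
        using ts kt at by (simp add: monoidal_simps)
      also have "\<dots> = q \<cdot> (ideal_action B' m k \<cdot> ((m \<boxtimes> \<one> A') \<boxtimes> \<one> B'))"
        unfolding a_def ideal_action_left_linear[OF B' k] ..
      finally show ?thesis using ts kt by (simp add: monoidal_simps)
    qed
    show ?thesis
      by (rule epic_cancel[OF a])
         (use ts at *[OF fg(1)] *[OF fg(2)] qt(7) in
            \<open>simp_all add: u_def[symmetric] v_def[symmetric] arr_simps tensor_arr\<close>)
  qed
  obtain R where R: "is_monoid C R" "is_monoid_morphism C B q R"
    and univ: "\<And>Z h. \<lbrakk>is_monoid C Z; is_monoid_morphism C B h Z; h \<cdot> u = h \<cdot> v\<rbrakk> \<Longrightarrow>
      \<exists>!k. is_monoid_morphism C R k Z \<and> k \<cdot> q = h"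
    using quotient_monoid[OF B' q _ right left] uv unfolding Bt Hom_iff by blast
  have qfg: "q \<cdot> f = q \<cdot> g"
  proof -
    define a where "a = \<ll> A' \<cdot> \<rho> (\<I> \<otimes> A')"
    have a: "epic C a"
      unfolding a_def by (intro epic_comp iso_epic left_unitor_iso right_unitor_iso)
        (use AB in \<open>simp_all add: monoidal_simps\<close>)
    have at: "a \<in> Arr C" "Cod C a = A'"
      using AB by (auto simp: a_def monoidal_simps)
    have *: "(q \<cdot> k) \<cdot> a = (q \<cdot> ideal_action B' m k) \<cdot> ((e \<boxtimes> \<one> A') \<boxtimes> e)"
      if k: "k \<in> Hom C A' B'" for k
    proof -
      have "(q \<cdot> k) \<cdot> a = q \<cdot> (k \<cdot> a)" using ts at k by (simp add: arr_simps)
      also have "\<dots> = q \<cdot> (ideal_action B' m k \<cdot> ((e \<boxtimes> \<one> A') \<boxtimes> e))"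
        unfolding a_def ideal_action_units[OF B' k] ..
      finally show ?thesis
        using ts ideal_action_arr[OF B' k] by (simp add: monoidal_simps)
    qed
    show ?thesis
      by (rule epic_cancel[OF a])
         (use ts at *[OF fg(1)] *[OF fg(2)] qt(7) in
            \<open>simp_all add: u_def[symmetric] v_def[symmetric] comp_arr\<close>)
  qed
  have "is_coequalizer (Mon C) F G (B, q, R)"
    unfolding is_coequalizer_def
  proof (intro exI conjI allI ballI impI)
    show "F \<in> Hom (Mon C) A B" "G \<in> Hom (Mon C) A B" by fact+
    show "(B, q, R) \<in> Hom (Mon C) B R" using B R by (simp add: Hom_Mon)
    show "(B, q, R) \<cdot>\<^bsub>Mon C\<^esub> F = (B, q, R) \<cdot>\<^bsub>Mon C\<^esub> G"
      using qfg by (simp add: Mon_def FG)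
    fix Z H
    assume H: "H \<in> Hom (Mon C) B Z" and HFG: "H \<cdot>\<^bsub>Mon C\<^esub> F = H \<cdot>\<^bsub>Mon C\<^esub> G"
    then obtain h where h: "H = (B, h, Z)" "is_monoid C Z" "is_monoid_morphism C B h Z"
      by (auto simp: Hom_Mon)
    have "h \<cdot> f = h \<cdot> g" using HFG by (simp add: Mon_def FG h)
    then have "h \<cdot> u = h \<cdot> v"
      using morphism_ideal_action[OF B' fg(1)] morphism_ideal_action[OF B' fg(2)] h(2,3)
      unfolding u_def v_def Bt by (cases Z) metis
    then have "\<exists>!k. is_monoid_morphism C R k Z \<and> k \<cdot> q = h" using univ h by blast
    then obtain k where k: "is_monoid_morphism C R k Z" "k \<cdot> q = h"
      and uniq: "\<And>k'. is_monoid_morphism C R k' Z \<Longrightarrow> k' \<cdot> q = h \<Longrightarrow> k' = k" by metis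
    show "\<exists>!K. K \<in> Hom (Mon C) R Z \<and> K \<cdot>\<^bsub>Mon C\<^esub> (B, q, R) = H"
    proof (rule ex1I[of _ "(R, k, Z)"])
      show "(R, k, Z) \<in> Hom (Mon C) R Z \<and> (R, k, Z) \<cdot>\<^bsub>Mon C\<^esub> (B, q, R) = H"
        using k R h by (simp add: Hom_Mon) (simp add: Mon_def)
      fix K assume K: "K \<in> Hom (Mon C) R Z \<and> K \<cdot>\<^bsub>Mon C\<^esub> (B, q, R) = H"
      then obtain k' where "K = (R, k', Z)" "is_monoid_morphism C R k' Z" by (auto simp: Hom_Mon)
      moreover from this K have "k' \<cdot> q = h" by (simp add: Mon_def h)
      ultimately show "K = (R, k, Z)" using uniq by simp
    qed
  qed
  then show "\<exists>q. is_coequalizer (Mon C) F G q" ..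
qed

end

section \<open>Colimits along a right adjoint\<close>

context cat_functor
begin

lemma on_arr_arr:
  assumes "f \<in> Arr C"
  shows "on_arr F f \<in> Arr D" "Dom D (on_arr F f) = on_obj F (Dom C f)"
    "Cod D (on_arr F f) = on_obj F (Cod C f)"
  using on_arr_in_Hom[of f "Dom C f" "Cod C f"] assms by (auto simp: Hom_iff)

lemma on_arr_comp_arr:
  assumes "f \<in> Arr C" "g \<in> Arr C" "Dom C g = Cod C f"
  shows "on_arr F (Comp C g f) = Comp D (on_arr F g) (on_arr F f)"
  using on_arr_comp[of f "Dom C f" "Cod C f" g "Cod C g"] assms by (auto simp: Hom_iff)

lemmas functor_simps = on_obj_in_Obj on_arr_arr on_arr_idt on_arr_comp_arr

end

definition comp_functor :: "('p, 'n, 'q, 'l) functor_data \<Rightarrow> ('o, 'm, 'p, 'n) functor_data \<Rightarrow>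
    ('o, 'm, 'q, 'l) functor_data"
  where "comp_functor G F = \<lparr>on_obj = on_obj G \<circ> on_obj F, on_arr = on_arr G \<circ> on_arr F\<rparr>"

lemma comp_functor_simps [simp]:
  "on_obj (comp_functor G F) A = on_obj G (on_obj F A)"
  "on_arr (comp_functor G F) f = on_arr G (on_arr F f)"
  by (simp_all add: comp_functor_def)

lemma cat_functor_comp:
  assumes "cat_functor C D F" "cat_functor D E G"
  shows "cat_functor C E (comp_functor G F)"
proof -
  interpret F: cat_functor C D F by fact
  interpret G: cat_functor D E G by fact
  show ?thesis
    by unfold_locales
       (auto simp: Hom_iff F.functor_simps G.functor_simps)
qed

lemma is_cocone_comp_functor:
  assumes "cat_functor J D E" "cat_functor D C U" "is_cocone J D E Y d"
  shows "is_cocone J C (comp_functor U E) (on_obj U Y) (\<lambda>i. on_arr U (d i))"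
proof -
  interpret E: cat_functor J D E by fact
  interpret U: cat_functor D C U by fact
  have d: "d i \<in> Hom D (on_obj E i) Y" if "i \<in> Obj J" for i
    using assms(3) that by (auto simp: is_cocone_def)
  show ?thesis
    using assms(3) unfolding is_cocone_def
    by (auto simp: U.on_obj_in_Obj U.on_arr_in_Hom U.on_arr_comp[OF E.on_arr_in_Hom d, symmetric])
qed

lemma colimit_factor:
  assumes "is_colimit J C D X c" "is_cocone J C D Y d"
  obtains k where "k \<in> Hom C X Y" "\<And>i. i \<in> Obj J \<Longrightarrow> Comp C k (c i) = d i"
  using assms unfolding is_colimit_def by metis

text \<open>Both arrows mediate from the colimit to the cocone \<open>i \<mapsto> k \<sqdot> c i\<close>.\<close>

lemma (in category) colimit_arrow_eqI:
  assumes X: "is_colimit J C D X c" and J: "cat_functor J C D"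
    and k: "k \<in> Hom C X Y" "k' \<in> Hom C X Y"
    and eq: "\<And>i. i \<in> Obj J \<Longrightarrow> k \<cdot> c i = k' \<cdot> c i"
  shows "k = k'"
proof -
  interpret D: cat_functor J C D by fact
  have c: "c i \<in> Hom C (on_obj D i) X" if "i \<in> Obj J" for i
    using X that by (auto simp: is_colimit_def is_cocone_def)
  have nat: "c j \<cdot> on_arr D u = c i" if "i \<in> Obj J" "j \<in> Obj J" "u \<in> Hom J i j" for i j u
    using X that by (auto simp: is_colimit_def is_cocone_def)
  have "is_cocone J C D Y (\<lambda>i. k \<cdot> c i)"
    unfolding is_cocone_def
  proof (intro conjI ballI)
    show "Y \<in> Obj C" using k cod_in_Obj by (auto simp: Hom_iff)
    show "k \<cdot> c i \<in> Hom C (on_obj D i) Y" if "i \<in> Obj J" for i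
      using comp_in_Hom[OF c[OF that] k(1)] .
    show "k \<cdot> c j \<cdot> on_arr D u = k \<cdot> c i" if "i \<in> Obj J" "j \<in> Obj J" "u \<in> Hom J i j" for i j u
      using comp_assoc[OF D.on_arr_in_Hom[OF that(3)] c[OF that(2)] k(1)] nat[OF that] by simp
  qed
  then have "\<exists>!l. l \<in> Hom C X Y \<and> (\<forall>i\<in>Obj J. l \<cdot> c i = k \<cdot> c i)"
    using X by (auto simp: is_colimit_def)
  then show ?thesis using k eq by metis
qed

locale adjunction =
  fixes C :: "('o, 'm, 'x) category_data_scheme" and D :: "('p, 'n, 'y) category_data_scheme"
    and F :: "('o, 'm, 'p, 'n) functor_data" and U :: "('p, 'n, 'o, 'm) functor_data"
    and \<phi> :: "'o \<Rightarrow> 'p \<Rightarrow> 'n \<Rightarrow> 'm"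
  assumes adj: "is_adjunction C D F U \<phi>"
begin

sublocale F: cat_functor C D F using adj by (simp add: is_adjunction_def)
sublocale U: cat_functor D C U using adj by (simp add: is_adjunction_def)

definition unit :: "'o \<Rightarrow> 'm"
  where "unit X = \<phi> X (on_obj F X) (Idt D (on_obj F X))"

text \<open>Naturality of \<open>\<phi>\<close> at an identity (Yoneda). With it the bijections \<open>\<phi>\<close> become the universal property
  of the unit, in the form of \<open>transpose_ex\<close> and \<open>transpose_inj\<close>.\<close>

lemma transpose_eq:
  assumes "X \<in> Obj C" "f \<in> Hom D (on_obj F X) A"
  shows "\<phi> X A f = Comp C (on_arr U f) (unit X)"
proof -
  have FX: "on_obj F X \<in> Obj D" and A: "A \<in> Obj D"
    using assms F.tgt.cod_in_Obj by (auto simp: F.on_obj_in_Obj Hom_iff)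
  have "\<phi> X A (Comp D f (Idt D (on_obj F X))) = Comp C (on_arr U f) (unit X)"
    using adj assms FX A F.tgt.idt_in_Hom[OF FX] unfolding is_adjunction_def unit_def by blast
  then show ?thesis using assms(2) F.tgt.comp_idt_right by metis
qed

lemma transpose_bij:
  "\<lbrakk>X \<in> Obj C; A \<in> Obj D\<rbrakk> \<Longrightarrow> bij_betw (\<phi> X A) (Hom D (on_obj F X) A) (Hom C X (on_obj U A))"
  using adj by (simp add: is_adjunction_def)

lemma unit_arr:
  assumes "X \<in> Obj C"
  shows "unit X \<in> Arr C" "Dom C (unit X) = X" "Cod C (unit X) = on_obj U (on_obj F X)"
proof -
  have FX: "on_obj F X \<in> Obj D" using assms by (simp add: F.on_obj_in_Obj)
  then have "bij_betw (\<phi> X (on_obj F X)) (Hom D (on_obj F X) (on_obj F X))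
      (Hom C X (on_obj U (on_obj F X)))"
    using transpose_bij assms by blast
  then have "unit X \<in> Hom C X (on_obj U (on_obj F X))"
    unfolding unit_def using F.tgt.idt_in_Hom[OF FX] by (auto dest: bij_betwE)
  then show "unit X \<in> Arr C" "Dom C (unit X) = X" "Cod C (unit X) = on_obj U (on_obj F X)"
    by (auto simp: Hom_iff)
qed

lemma transpose_ex:
  assumes "X \<in> Obj C" "A \<in> Obj D" "g \<in> Hom C X (on_obj U A)"
  obtains f where "f \<in> Hom D (on_obj F X) A" "Comp C (on_arr U f) (unit X) = g"
proof -
  obtain f where "f \<in> Hom D (on_obj F X) A" "\<phi> X A f = g"
    using bij_betw_imp_surj_on[OF transpose_bij[OF assms(1,2)]] assms(3) by (metis imageE)
  then show ?thesis using that transpose_eq[OF assms(1)] by metis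
qed

lemma transpose_inj:
  assumes X: "X \<in> Obj C" and f: "f \<in> Hom D (on_obj F X) A" "f' \<in> Hom D (on_obj F X) A"
    and eq: "Comp C (on_arr U f) (unit X) = Comp C (on_arr U f') (unit X)"
  shows "f = f'"
proof -
  have "A \<in> Obj D" using f(1) F.tgt.cod_in_Obj by (auto simp: Hom_iff)
  then show ?thesis
    using inj_onD[OF bij_betw_imp_inj_on[OF transpose_bij[OF X]]] f eq transpose_eq[OF X] by metis
qed

lemma unit_natural:
  assumes h: "h \<in> Hom C X X'"
  shows "Comp C (on_arr U (on_arr F h)) (unit X) = Comp C (unit X') h"
proof -
  have X: "X \<in> Obj C" "X' \<in> Obj C"
    using h F.src.dom_in_Obj F.src.cod_in_Obj by (auto simp: Hom_iff)
  note Fh = F.on_arr_in_Hom[OF h]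
  have FX': "on_obj F X' \<in> Obj D" using X by (simp add: F.on_obj_in_Obj)
  have "\<phi> X (on_obj F X') (Comp D (Idt D (on_obj F X')) (on_arr F h)) = Comp C (unit X') h"
    using adj X FX' h F.tgt.idt_in_Hom[OF FX'] unfolding is_adjunction_def unit_def by blast
  then show ?thesis using transpose_eq[OF X(1) Fh] F.tgt.comp_idt_left[OF Fh] by simp
qed

text \<open>The second property, a triangle identity, makes \<open>on_arr U \<epsilon>\<close> split epi with section the unit.\<close>

lemma counit_ex:
  assumes "A \<in> Obj D"
  obtains \<epsilon> where "\<epsilon> \<in> Hom D (on_obj F (on_obj U A)) A"
    "Comp C (on_arr U \<epsilon>) (unit (on_obj U A)) = Idt C (on_obj U A)"
  using transpose_ex[OF U.on_obj_in_Obj[OF assms] assms F.src.idt_in_Hom[OF U.on_obj_in_Obj[OF assms]]]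
  by blast

text \<open>The hypotheses \<open>faithful\<close> and \<open>lift\<close> replace monadicity of \<open>U\<close>: an arrow of \<open>C\<close> between
  underlying objects comes from \<open>D\<close> if it does so after precomposition with an arrow of \<open>D\<close> that splits
  in \<open>C\<close>. Applied to the counits, this reduces the requirement that a cocone in \<open>C\<close> lift to \<open>D\<close> to
  equations between arrows, and one coequalizer in \<open>D\<close> imposes them all.\<close>

theorem colimits_along_right_adjoint:
  fixes J :: "('i, 'j, 'z) category_data_scheme"
  assumes coeq: "has_coequalizers D"
    and faithful: "\<And>a b f g. \<lbrakk>f \<in> Hom D a b; g \<in> Hom D a b; on_arr U f = on_arr U g\<rbrakk> \<Longrightarrow> f = g"
    and lift: "\<And>a b z e s h g. \<lbrakk>e \<in> Hom D a b; s \<in> Hom C (on_obj U b) (on_obj U a);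
        Comp C (on_arr U e) s = Idt C (on_obj U b); h \<in> Hom D a z;
        g \<in> Hom C (on_obj U b) (on_obj U z); Comp C g (on_arr U e) = on_arr U h\<rbrakk> \<Longrightarrow>
      \<exists>g'\<in>Hom D b z. on_arr U g' = g"
    and colim: "\<And>E. cat_functor J C E \<Longrightarrow> \<exists>X c. is_colimit J C E X c"
    and E: "cat_functor J D E"
  shows "\<exists>X c. is_colimit J D E X c"
proof -
  interpret E: cat_functor J D E by fact
  note simps = F.src.arr_simps F.tgt.arr_simps F.functor_simps U.functor_simps E.functor_simps
    unit_arr
  define UE where "UE = comp_functor U E"
  define TUE where "TUE = comp_functor U (comp_functor F UE)"
  have UE: "cat_functor J C UE"
    unfolding UE_def by (rule cat_functor_comp[OF E U.cat_functor_axioms])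
  have TUE: "cat_functor J C TUE"
    unfolding TUE_def by (intro cat_functor_comp[OF _ U.cat_functor_axioms]
        cat_functor_comp[OF _ F.cat_functor_axioms] UE)
  obtain X c where X: "is_colimit J C UE X c" using colim[OF UE] by blast
  obtain L l where L: "is_colimit J C TUE L l" using colim[OF TUE] by blast
  have XO: "X \<in> Obj C" and c: "\<And>i. i \<in> Obj J \<Longrightarrow> c i \<in> Hom C (on_obj U (on_obj E i)) X"
    and c_nat: "\<And>i j u. \<lbrakk>i \<in> Obj J; j \<in> Obj J; u \<in> Hom J i j\<rbrakk> \<Longrightarrow>
      Comp C (c j) (on_arr U (on_arr E u)) = c i"
    using X by (auto simp: is_colimit_def is_cocone_def UE_def)
  have LO: "L \<in> Obj C"
    and l: "\<And>i. i \<in> Obj J \<Longrightarrow> l i \<in> Hom C (on_obj U (on_obj F (on_obj U (on_obj E i)))) L"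
    using L by (auto simp: is_colimit_def is_cocone_def TUE_def UE_def)
  have EO: "on_obj E i \<in> Obj D" "on_obj U (on_obj E i) \<in> Obj C" if "i \<in> Obj J" for i
    using that by (simp_all add: simps)
  define FX where "FX = on_obj F X"
  have FXO: "FX \<in> Obj D" using XO by (simp add: FX_def simps)
  have "\<forall>i. \<exists>\<epsilon>. i \<in> Obj J \<longrightarrow> \<epsilon> \<in> Hom D (on_obj F (on_obj U (on_obj E i))) (on_obj E i) \<and>
      Comp C (on_arr U \<epsilon>) (unit (on_obj U (on_obj E i))) = Idt C (on_obj U (on_obj E i))"
    using counit_ex EO by metis
  then obtain \<epsilon> where \<epsilon>: "\<And>i. i \<in> Obj J \<Longrightarrow>
        \<epsilon> i \<in> Hom D (on_obj F (on_obj U (on_obj E i))) (on_obj E i)"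
    and \<epsilon>_unit: "\<And>i. i \<in> Obj J \<Longrightarrow>
      Comp C (on_arr U (\<epsilon> i)) (unit (on_obj U (on_obj E i))) = Idt C (on_obj U (on_obj E i))"
    by metis
  have \<epsilon>_transpose: "Comp C (on_arr U (Comp D k (\<epsilon> i))) (unit (on_obj U (on_obj E i))) = on_arr U k"
    if "i \<in> Obj J" "k \<in> Hom D (on_obj E i) Y" for i k Y
    using that \<epsilon>[OF that(1)] EO[OF that(1)] \<epsilon>_unit[OF that(1)] by (simp add: simps)
  have \<epsilon>_nat: "Comp D (\<epsilon> j) (on_arr F (on_arr U (on_arr E u))) = Comp D (on_arr E u) (\<epsilon> i)"
    if ij: "i \<in> Obj J" "j \<in> Obj J" "u \<in> Hom J i j" for i j u
  proof (rule transpose_inj[OF EO(2)[OF ij(1)]])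
    note Eu = E.on_arr_in_Hom[OF ij(3)]
    note ts = Eu \<epsilon>[OF ij(1)] \<epsilon>[OF ij(2)] EO[OF ij(1)] EO[OF ij(2)]
    show "Comp D (\<epsilon> j) (on_arr F (on_arr U (on_arr E u)))
        \<in> Hom D (on_obj F (on_obj U (on_obj E i))) (on_obj E j)"
      "Comp D (on_arr E u) (\<epsilon> i) \<in> Hom D (on_obj F (on_obj U (on_obj E i))) (on_obj E j)"
      using ts by (auto simp: simps)
    have "Comp C (on_arr U (Comp D (\<epsilon> j) (on_arr F (on_arr U (on_arr E u)))))
        (unit (on_obj U (on_obj E i))) = Comp C (on_arr U (\<epsilon> j))
        (Comp C (on_arr U (on_arr F (on_arr U (on_arr E u)))) (unit (on_obj U (on_obj E i))))"
      using ts by (simp add: simps)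
    also have "\<dots> = Comp C (Comp C (on_arr U (\<epsilon> j)) (unit (on_obj U (on_obj E j))))
        (on_arr U (on_arr E u))"
      unfolding unit_natural[OF U.on_arr_in_Hom[OF Eu]] using ts by (simp add: simps)
    also have "\<dots> = on_arr U (on_arr E u)"
      unfolding \<epsilon>_unit[OF ij(2)] using ts by (simp add: simps)
    finally show "Comp C (on_arr U (Comp D (\<epsilon> j) (on_arr F (on_arr U (on_arr E u)))))
        (unit (on_obj U (on_obj E i))) =
        Comp C (on_arr U (Comp D (on_arr E u) (\<epsilon> i))) (unit (on_obj U (on_obj E i)))"
      using \<epsilon>_transpose[OF ij(1) Eu] by simp
  qed
  \<comment> \<open>\<open>\<sigma> i\<close> underlies the transpose of \<open>unit X \<sqdot> c i\<close>, so \<open>\<sigma> i = \<tau> i\<close> would express that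
    \<open>unit X \<sqdot> c i\<close> comes from an arrow of \<open>D\<close>. The coequalizer \<open>p\<close> makes this true after composition.\<close>
  define \<sigma> where "\<sigma> i = on_arr U (on_arr F (c i))" for i
  define \<tau> where "\<tau> i = Comp C (Comp C (unit X) (c i)) (on_arr U (\<epsilon> i))" for i
  have \<sigma>: "is_cocone J C TUE (on_obj U FX) \<sigma>"
    unfolding is_cocone_def
  proof (intro conjI ballI)
    show "on_obj U FX \<in> Obj C" using FXO by (simp add: simps)
    show "\<sigma> i \<in> Hom C (on_obj TUE i) (on_obj U FX)" if "i \<in> Obj J" for i
      using c[OF that] by (simp add: \<sigma>_def TUE_def UE_def FX_def simps)
    show "Comp C (\<sigma> j) (on_arr TUE u) = \<sigma> i" if "i \<in> Obj J" "j \<in> Obj J" "u \<in> Hom J i j" for i j u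
      using c[OF that(2)] E.on_arr_in_Hom[OF that(3)]
      by (simp add: \<sigma>_def TUE_def UE_def Hom_iff U.on_arr_comp_arr[symmetric] simps(1)
          F.on_arr_comp_arr[symmetric] F.on_arr_arr U.on_arr_arr c_nat[OF that])
  qed
  have \<tau>: "is_cocone J C TUE (on_obj U FX) \<tau>"
    unfolding is_cocone_def
  proof (intro conjI ballI)
    show "on_obj U FX \<in> Obj C" using FXO by (simp add: simps)
    show "\<tau> i \<in> Hom C (on_obj TUE i) (on_obj U FX)" if "i \<in> Obj J" for i
      using c[OF that] \<epsilon>[OF that] XO by (simp add: \<tau>_def TUE_def UE_def FX_def simps)
    fix i j u assume ij: "i \<in> Obj J" "j \<in> Obj J" "u \<in> Hom J i j"
    note ts = E.on_arr_in_Hom[OF ij(3)] \<epsilon>[OF ij(1)] \<epsilon>[OF ij(2)] EO[OF ij(1)] EO[OF ij(2)]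
      c[OF ij(1)] c[OF ij(2)] XO
    have "Comp C (\<tau> j) (on_arr TUE u) = Comp C (Comp C (unit X) (c j))
        (on_arr U (Comp D (\<epsilon> j) (on_arr F (on_arr U (on_arr E u)))))"
      using ts by (simp add: \<tau>_def TUE_def UE_def simps)
    also have "\<dots> = Comp C (Comp C (unit X) (Comp C (c j) (on_arr U (on_arr E u)))) (on_arr U (\<epsilon> i))"
      unfolding \<epsilon>_nat[OF ij] using ts by (simp add: simps)
    finally show "Comp C (\<tau> j) (on_arr TUE u) = \<tau> i"
      unfolding c_nat[OF ij] \<tau>_def .
  qed
  obtain s' where s': "s' \<in> Hom C L (on_obj U FX)" "\<And>i. i \<in> Obj J \<Longrightarrow> Comp C s' (l i) = \<sigma> i"
    using colimit_factor[OF L \<sigma>] by metis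
  obtain t' where t': "t' \<in> Hom C L (on_obj U FX)" "\<And>i. i \<in> Obj J \<Longrightarrow> Comp C t' (l i) = \<tau> i"
    using colimit_factor[OF L \<tau>] by metis
  obtain s where s: "s \<in> Hom D (on_obj F L) FX" "Comp C (on_arr U s) (unit L) = s'"
    using transpose_ex[OF LO FXO s'(1)] .
  obtain t where t: "t \<in> Hom D (on_obj F L) FX" "Comp C (on_arr U t) (unit L) = t'"
    using transpose_ex[OF LO FXO t'(1)] .
  \<comment> \<open>The colimit \<open>L\<close> and the adjunction turn the family of equations into a single one.\<close>
  have coequalizes_iff: "Comp D k s = Comp D k t \<longleftrightarrow>
      (\<forall>i\<in>Obj J. Comp C (on_arr U k) (\<sigma> i) = Comp C (on_arr U k) (\<tau> i))"
    if k: "k \<in> Hom D FX Y" for k Y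
  proof -
    have s_i: "Comp C (Comp C (on_arr U (Comp D k s)) (unit L)) (l i) = Comp C (on_arr U k) (\<sigma> i)"
      and t_i: "Comp C (Comp C (on_arr U (Comp D k t)) (unit L)) (l i) = Comp C (on_arr U k) (\<tau> i)"
      if "i \<in> Obj J" for i
      unfolding s'(2)[OF that, symmetric] t'(2)[OF that, symmetric] s(2)[symmetric] t(2)[symmetric]
      using s(1) t(1) k LO l[OF that] by (simp_all add: simps)
    have "Comp D k s = Comp D k t"
      if eq: "\<forall>i\<in>Obj J. Comp C (on_arr U k) (\<sigma> i) = Comp C (on_arr U k) (\<tau> i)"
    proof (rule transpose_inj[OF LO])
      show "Comp D k s \<in> Hom D (on_obj F L) Y" "Comp D k t \<in> Hom D (on_obj F L) Y"
        using s(1) t(1) k by (auto simp: simps)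
      show "Comp C (on_arr U (Comp D k s)) (unit L) = Comp C (on_arr U (Comp D k t)) (unit L)"
        by (rule F.src.colimit_arrow_eqI[OF L TUE, where Y = "on_obj U Y"])
           (use eq s_i t_i s(1) t(1) k LO in \<open>auto simp: simps\<close>)
    qed
    then show ?thesis using s_i t_i by metis
  qed
  obtain p where p: "is_coequalizer D s t p"
    using coeq s(1) t(1) unfolding has_coequalizers_def by blast
  define P where "P = Cod D p"
  have pt: "p \<in> Hom D FX P" and pst: "Comp D p s = Comp D p t"
    using F.tgt.coequalizer_arr[OF p] s(1) by (auto simp: P_def Hom_iff)
  have PO: "P \<in> Obj D" using pt F.tgt.cod_in_Obj by (auto simp: Hom_iff)
  define g where "g i = Comp C (on_arr U p) (Comp C (unit X) (c i))" for i
  have g: "g i \<in> Hom C (on_obj U (on_obj E i)) (on_obj U P)" if "i \<in> Obj J" for i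
    using pt c[OF that] XO by (simp add: g_def FX_def simps)
  \<comment> \<open>The component \<open>g i\<close> lifts because its composite with the counit underlies \<open>p \<sqdot> F (c i)\<close>.\<close>
  have "\<exists>d\<in>Hom D (on_obj E i) P. on_arr U d = g i" if i: "i \<in> Obj J" for i
  proof (rule lift[OF \<epsilon>[OF i] _ \<epsilon>_unit[OF i] _ g[OF i]])
    show "unit (on_obj U (on_obj E i)) \<in>
        Hom C (on_obj U (on_obj E i)) (on_obj U (on_obj F (on_obj U (on_obj E i))))"
      using EO[OF i] by (simp add: simps)
    show "Comp D p (on_arr F (c i)) \<in> Hom D (on_obj F (on_obj U (on_obj E i))) P"
      using pt c[OF i] by (simp add: FX_def simps)
    have "Comp C (g i) (on_arr U (\<epsilon> i)) = Comp C (on_arr U p) (\<tau> i)"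
      using pt c[OF i] \<epsilon>[OF i] XO by (simp add: g_def \<tau>_def FX_def simps)
    also have "\<dots> = Comp C (on_arr U p) (\<sigma> i)"
      using coequalizes_iff[OF pt] pst i by simp
    finally show "Comp C (g i) (on_arr U (\<epsilon> i)) = on_arr U (Comp D p (on_arr F (c i)))"
      using pt c[OF i] by (simp add: \<sigma>_def FX_def simps)
  qed
  then obtain d where d: "\<And>i. i \<in> Obj J \<Longrightarrow> d i \<in> Hom D (on_obj E i) P"
    and Ud: "\<And>i. i \<in> Obj J \<Longrightarrow> on_arr U (d i) = g i"
    by metis
  have "is_colimit J D E P d"
    unfolding is_colimit_def
  proof (intro conjI allI impI)
    show "is_cocone J D E P d"
      unfolding is_cocone_def
    proof (intro conjI ballI PO d)
      fix i j u assume ij: "i \<in> Obj J" "j \<in> Obj J" "u \<in> Hom J i j"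
      note Eu = E.on_arr_in_Hom[OF ij(3)]
      show "Comp D (d j) (on_arr E u) = d i"
      proof (rule faithful)
        show "Comp D (d j) (on_arr E u) \<in> Hom D (on_obj E i) P" "d i \<in> Hom D (on_obj E i) P"
          using d[OF ij(1)] d[OF ij(2)] Eu by (auto simp: simps)
        have "on_arr U (Comp D (d j) (on_arr E u)) = Comp C (g j) (on_arr U (on_arr E u))"
          unfolding Ud[OF ij(2), symmetric] using d[OF ij(2)] Eu by (simp add: simps)
        also have "\<dots> = Comp C (on_arr U p) (Comp C (unit X) (Comp C (c j) (on_arr U (on_arr E u))))"
          unfolding g_def using pt c[OF ij(2)] Eu XO by (simp add: FX_def simps)
        finally show "on_arr U (Comp D (d j) (on_arr E u)) = on_arr U (d i)"
          unfolding c_nat[OF ij] Ud[OF ij(1)] g_def .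
      qed
    qed
    fix Y y assume y: "is_cocone J D E Y y"
    have YO: "Y \<in> Obj D" and yi: "\<And>i. i \<in> Obj J \<Longrightarrow> y i \<in> Hom D (on_obj E i) Y"
      using y by (auto simp: is_cocone_def)
    obtain k0 where k0: "k0 \<in> Hom C X (on_obj U Y)" "\<And>i. i \<in> Obj J \<Longrightarrow> Comp C k0 (c i) = on_arr U (y i)"
      using colimit_factor[OF X is_cocone_comp_functor[OF E U.cat_functor_axioms y, folded UE_def]]
      by metis
    obtain k where k: "k \<in> Hom D FX Y" "Comp C (on_arr U k) (unit X) = k0"
      using transpose_ex[OF XO YO k0(1)] unfolding FX_def .
    have k_i: "Comp C (on_arr U k) (Comp C (unit X) (c i)) = on_arr U (y i)" if "i \<in> Obj J" for i
      unfolding k0(2)[OF that, symmetric] k(2)[symmetric]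
      using k(1) c[OF that] XO by (simp add: FX_def simps)
    \<comment> \<open>On a leg that comes from \<open>D\<close> the two relations agree: both composites underlie \<open>y i \<sqdot> \<epsilon> i\<close>.\<close>
    have "Comp D k s = Comp D k t"
      unfolding coequalizes_iff[OF k(1)]
    proof
      fix i assume i: "i \<in> Obj J"
      have "Comp D k (on_arr F (c i)) = Comp D (y i) (\<epsilon> i)"
      proof (rule transpose_inj[OF EO(2)[OF i]])
        show "Comp D k (on_arr F (c i)) \<in> Hom D (on_obj F (on_obj U (on_obj E i))) Y"
          "Comp D (y i) (\<epsilon> i) \<in> Hom D (on_obj F (on_obj U (on_obj E i))) Y"
          using k(1) c[OF i] yi[OF i] \<epsilon>[OF i] by (auto simp: FX_def simps)
        have "Comp C (on_arr U (Comp D k (on_arr F (c i)))) (unit (on_obj U (on_obj E i))) =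
            Comp C (on_arr U k) (Comp C (on_arr U (on_arr F (c i))) (unit (on_obj U (on_obj E i))))"
          using k(1) c[OF i] EO[OF i] by (simp add: FX_def simps)
        also have "\<dots> = on_arr U (y i)"
          unfolding unit_natural[OF c[OF i]] by (rule k_i[OF i])
        finally show "Comp C (on_arr U (Comp D k (on_arr F (c i)))) (unit (on_obj U (on_obj E i))) =
            Comp C (on_arr U (Comp D (y i) (\<epsilon> i))) (unit (on_obj U (on_obj E i)))"
          unfolding \<epsilon>_transpose[OF i yi[OF i]] .
      qed
      then have "Comp C (on_arr U k) (\<sigma> i) = Comp C (on_arr U (y i)) (on_arr U (\<epsilon> i))"
        using k(1) c[OF i] yi[OF i] \<epsilon>[OF i]
        by (simp add: \<sigma>_def FX_def Hom_iff U.on_arr_comp_arr[symmetric] F.on_arr_arr)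
      also have "\<dots> = Comp C (on_arr U k) (\<tau> i)"
        unfolding k_i[OF i, symmetric] \<tau>_def
        using k(1) c[OF i] \<epsilon>[OF i] XO by (simp add: FX_def simps)
      finally show "Comp C (on_arr U k) (\<sigma> i) = Comp C (on_arr U k) (\<tau> i)" .
    qed
    then obtain k' where k': "k' \<in> Hom D P Y" "Comp D k' p = k"
      using F.tgt.coequalizer_factor[OF p, of k] k(1) s(1) by (auto simp: P_def Hom_iff)
    have U_comp_d: "on_arr U (Comp D j (d i)) = Comp C (on_arr U (Comp D j p)) (Comp C (unit X) (c i))"
      if "j \<in> Hom D P Y" "i \<in> Obj J" for i j
    proof -
      have "on_arr U (Comp D j (d i)) = Comp C (on_arr U j) (g i)"
        unfolding Ud[OF that(2), symmetric] using that(1) d[OF that(2)] by (simp add: simps)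
      then show ?thesis
        using that(1) pt c[OF that(2)] XO by (simp add: g_def FX_def simps)
    qed
    show "\<exists>!k. k \<in> Hom D P Y \<and> (\<forall>i\<in>Obj J. Comp D k (d i) = y i)"
    proof (rule ex1I[of _ k'])
      have "Comp D k' (d i) = y i" if i: "i \<in> Obj J" for i
        by (rule faithful[OF F.tgt.comp_in_Hom[OF d[OF i] k'(1)] yi[OF i]])
           (simp add: U_comp_d[OF k'(1) i] k'(2) k_i[OF i])
      then show "k' \<in> Hom D P Y \<and> (\<forall>i\<in>Obj J. Comp D k' (d i) = y i)" using k' by blast
      fix j assume j: "j \<in> Hom D P Y \<and> (\<forall>i\<in>Obj J. Comp D j (d i) = y i)"
      then have jt: "j \<in> Hom D P Y" by blast
      have jp: "Comp D j p \<in> Hom D FX Y" using jt pt by (simp add: simps)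
      \<comment> \<open>An arrow out of \<open>P\<close> is determined by its composites with the legs \<open>d i\<close>: cancel \<open>p\<close>, transpose
        along the adjunction, and test on the colimit \<open>X\<close>.\<close>
      have "Comp C (on_arr U (Comp D j p)) (unit X) = k0"
      proof (rule F.src.colimit_arrow_eqI[OF X UE _ k0(1)])
        show "Comp C (on_arr U (Comp D j p)) (unit X) \<in> Hom C X (on_obj U Y)"
          using jp XO by (simp add: FX_def Hom_iff U.on_arr_arr unit_arr F.src.comp_arr)
        fix i assume i: "i \<in> Obj J"
        have "Comp C (Comp C (on_arr U (Comp D j p)) (unit X)) (c i) = on_arr U (Comp D j (d i))"
          unfolding U_comp_d[OF jt i] using jp XO c[OF i]
          by (simp add: FX_def Hom_iff U.on_arr_arr unit_arr F.src.comp_assoc_arr)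
        then show "Comp C (Comp C (on_arr U (Comp D j p)) (unit X)) (c i) = Comp C k0 (c i)"
          using j i k0(2)[OF i] by simp
      qed
      then have "Comp D j p = Comp D k' p"
        using transpose_inj[OF XO jp[unfolded FX_def] k(1)[unfolded FX_def]] k(2) k'(2) by simp
      then show "j = k'"
        using F.tgt.epic_cancel[OF F.tgt.coequalizer_epic[OF p], of j k'] jt k'(1)
        by (simp add: Hom_iff P_def)
    qed
  qed
  then show ?thesis by blast
qed

end

section \<open>Colimits of monoids\<close>

lemma (in monoidal_category) forgetful_faithful:
  assumes "f \<in> Hom (Mon C) A B" "g \<in> Hom (Mon C) A B"
    "on_arr (forgetful C) f = on_arr (forgetful C) g"
  shows "f = g"
  using assms by (auto simp: Hom_Mon forgetful_def)

text \<open>A tensor square of a split epi is again split, hence can be cancelled in the morphism law.\<close>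

lemma (in monoidal_category) forgetful_lifts_through_split_epi:
  assumes e: "e \<in> Hom (Mon C) A B"
    and s: "s \<in> Hom C (on_obj (forgetful C) B) (on_obj (forgetful C) A)"
      "on_arr (forgetful C) e \<cdot> s = \<one> (on_obj (forgetful C) B)"
    and h: "h \<in> Hom (Mon C) A Z"
    and g: "g \<in> Hom C (on_obj (forgetful C) B) (on_obj (forgetful C) Z)"
      "g \<cdot> on_arr (forgetful C) e = on_arr (forgetful C) h"
  shows "\<exists>g'\<in>Hom (Mon C) B Z. on_arr (forgetful C) g' = g"
proof -
  obtain A' m n where A: "A = (A', m, n)" by (cases A)
  obtain B' m' n' where B: "B = (B', m', n')" by (cases B)
  obtain Z' m'' n'' where Z: "Z = (Z', m'', n'')" by (cases Z)
  obtain e' h' where eh: "e = (A, e', B)" "h = (A, h', Z)" and M: "is_monoid C A" "is_monoid C B"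
    "is_monoid C Z" and e': "is_monoid_morphism C A e' B" and h': "is_monoid_morphism C A h' Z"
    using e h by (auto simp: Hom_Mon)
  have t: "s \<in> Hom C B' A'" "e' \<cdot> s = \<one> B'" "g \<in> Hom C B' Z'" "g \<cdot> e' = h'" "e' \<in> Hom C A' B'"
    using s g monoid_morphism_Hom[OF e'] by (auto simp: forgetful_def A B Z eh)
  have O: "A' \<in> Obj C" "B' \<in> Obj C" using HomD[OF t(1)] by auto
  have "epic C (e' \<boxtimes> e')"
    by (rule split_epic[of _ "A' \<otimes> A'" "B' \<otimes> B'" "s \<boxtimes> s"])
       (use t O in \<open>simp_all add: monoidal_simps\<close>)
  then have "is_monoid_morphism C B g Z"
    using monoid_morphism_cancel_epic M e' h' t unfolding A B Z by blast
  then show ?thesis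
    using M by (intro bexI[of _ "(B, g, Z)"]) (auto simp: Hom_Mon forgetful_def)
qed

theorem proposition10:
  fixes C :: "('o, 'm, 'x) monoidal_data_scheme"
    and \<kappa> :: "'k rel"
  assumes "monoidal_category C"
    and "has_coequalizers C"
    and "tensor_preserves_coequalizers C"
    and "has_left_adjoint (Mon C) C (forgetful C)"
    and "Card_order \<kappa>"
  shows "has_coequalizers (Mon C) \<and> (cocomplete \<kappa> C \<longrightarrow> cocomplete \<kappa> (Mon C))"
proof (intro conjI impI)
  interpret coequalizer_preserving_tensor C
    using assms(1,3)
    by (intro coequalizer_preserving_tensor.intro coequalizer_preserving_tensor_axioms.intro)
  show coeq: "has_coequalizers (Mon C)" by (rule has_coequalizers_Mon[OF assms(2)])
  assume cocomplete: "cocomplete \<kappa> C"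
  obtain F \<phi> where "is_adjunction C (Mon C) F (forgetful C) \<phi>"
    using assms(4) unfolding has_left_adjoint_def by blast
  then interpret free: adjunction C "Mon C" F "forgetful C" \<phi> by (rule adjunction.intro)
  show "cocomplete \<kappa> (Mon C)"
    unfolding cocomplete_def
  proof (intro allI impI)
    fix J :: "('k, 'k) category_data" and E
    assume J: "small_category \<kappa> J \<and> cat_functor J (Mon C) E"
    show "\<exists>X c. is_colimit J (Mon C) E X c"
    proof (rule free.colimits_along_right_adjoint[OF coeq])
      show "\<And>E. cat_functor J C E \<Longrightarrow> \<exists>X c. is_colimit J C E X c"
        using cocomplete J unfolding cocomplete_def by blast
      show "cat_functor J (Mon C) E" using J ..
    qed (fact forgetful_faithful forgetful_lifts_through_split_epi)+
  qed
qed

end
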